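(* Let $a>b>0$, $c^2=a^2-b^2$, let $\mathcal{E}$ be the ellipse $x^2/a^2+y^2/b^2=1$, and let $C=[x_c,y_c]$ be a point interior to $\mathcal{E}$. Let $\mathcal{T}_\circ$ be the Poncelet family of triangles inscribed in $\mathcal{E}$ and circumscribing a circle centered at $C$, and let $\mathcal{L}_3$ be the (elliptic) locus of the circumcenter $X_3$ over $\mathcal{T}_\circ$. Then the foci $F_3,F_3'$ of $\mathcal{L}_3$ are collinear with $C$ and each lies on an axis of $\mathcal{E}$, namely \[ F_3=\left[x_c\left(1-(b/a)^2\right),0\right],\qquad F_3'=\left[0,y_c\left(1-(a/b)^2\right)\right]. \] Furthermore, the semi-axis lengths $a_3$ (major) and $b_3$ (minor) of $\mathcal{L}_3$ are \[ a_3=\delta_3\,\frac{a}{b}-\delta_3'\,\frac{b}{a},\qquad b_3=\delta_3'-\delta_3, \] where $\delta_3=\frac{\sqrt{b^4+c^2y_c^2}}{2b}$ and $\delta_3'=\frac{\sqrt{a^4-c^2x_c^2}}{2a}$.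
   Context: For each point $C=[x_c,y_c]$ interior to $\mathcal{E}$ there is exactly one circle $\mathcal{K}$ centered at $C$, nested in $\mathcal{E}$, admitting triangles inscribed in $\mathcal{E}$ with all sides tangent to $\mathcal{K}$; its radius is $r=\big(b\sqrt{a^4-c^2x_c^2}-a\sqrt{b^4+c^2y_c^2}\big)/c^2$. By Poncelet's porism every point of $\mathcal{E}$ is then a vertex of exactly one such triangle. $\mathcal{T}_\circ$ is the family of all these triangles; $\mathcal{K}$ is their common incircle. The locus $\mathcal{L}_k$ of a triangle center $X_k$ is the set of positions of $X_k(T)$ as $T$ ranges over $\mathcal{T}_\circ$. It is known that $\mathcal{L}_3$ is an ellipse. A circle counts as an ellipse with coinciding foci. *)

theory Defs
  imports "HOL-Analysis.Analysis"
begin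

type_synonym point = "real \<times> real"

definition ellipse :: "real \<Rightarrow> real \<Rightarrow> point set" where
  "ellipse a b = {(x, y). x\<^sup>2 / a\<^sup>2 + y\<^sup>2 / b\<^sup>2 = 1}"

definition ellipse_interior :: "real \<Rightarrow> real \<Rightarrow> point set" where
  "ellipse_interior a b = {(x, y). x\<^sup>2 / a\<^sup>2 + y\<^sup>2 / b\<^sup>2 < 1}"

definition tangent_to_circle :: "point \<Rightarrow> real \<Rightarrow> point \<Rightarrow> point \<Rightarrow> bool" where
  "tangent_to_circle C r P Q \<longleftrightarrow> (\<exists>T. affine hull {P, Q} \<inter> sphere C r = {T})"

text \<open>
  The circle is required to lie strictly inside the ellipse. Hence its point of contact with a
  line through two points of the ellipse lies on the chord itself, and a circle touching all three
  side lines of an inscribed triangle is its incircle, never an excircle. The radius is not a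
  parameter: for given \<open>a\<close>, \<open>b\<close>, \<open>C\<close> only one radius admits such triangles. Triangles are ordered
  triples of vertices.
\<close>
definition poncelet_family :: "real \<Rightarrow> real \<Rightarrow> point \<Rightarrow> (point \<times> point \<times> point) set" where
  "poncelet_family a b C =
    {(P, Q, R). {P, Q, R} \<subseteq> ellipse a b \<and> \<not> collinear {P, Q, R} \<and>
      (\<exists>r>0. sphere C r \<subseteq> ellipse_interior a b \<and>
        tangent_to_circle C r P Q \<and> tangent_to_circle C r Q R \<and> tangent_to_circle C r R P)}"

definition circumcenter :: "point \<times> point \<times> point \<Rightarrow> point" where
  "circumcenter = (\<lambda>(P, Q, R). THE X. dist X P = dist X Q \<and> dist X Q = dist X R)"

definition circumcenter_locus :: "real \<Rightarrow> real \<Rightarrow> point \<Rightarrow> point set" where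
  "circumcenter_locus a b C = circumcenter ` poncelet_family a b C"

text \<open>
  \<open>is_ellipse L F F' \<alpha> \<beta>\<close>: the set \<open>L\<close> is the nondegenerate ellipse with foci \<open>F\<close>, \<open>F'\<close>, major
  semi-axis \<open>\<alpha>\<close> and minor semi-axis \<open>\<beta>\<close>. The case \<open>F = F'\<close>, which forces \<open>\<alpha> = \<beta>\<close>, is the circle.
\<close>
definition is_ellipse :: "point set \<Rightarrow> point \<Rightarrow> point \<Rightarrow> real \<Rightarrow> real \<Rightarrow> bool" where
  "is_ellipse L F F' \<alpha> \<beta> \<longleftrightarrow>
     0 < \<beta> \<and> \<beta> \<le> \<alpha> \<and> (dist F F' / 2)\<^sup>2 = \<alpha>\<^sup>2 - \<beta>\<^sup>2 \<and>
     L = {X. dist X F + dist X F' = 2 * \<alpha>}"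

end

theory Submission
  imports Defs "HOL-Computational_Algebra.Fundamental_Theorem_Algebra"
begin

text \<open>
  Scaling the axes turns the ellipse into the unit circle, with vertices \<open>u, v, w\<close>, and the inscribed
  circle into an ellipse with centre \<open>m\<close> and foci \<open>f, g\<close>. The chord \<open>uv\<close> is tangent to the circle iff
  a polynomial symmetric in \<open>u, v\<close> vanishes. For three distinct vertices with tangent sides this means
  that \<open>u, v, w\<close> are the solutions \<open>z\<close> of the Blaschke equation
  \<open>z (z - f) (z - g) = l (1 - cnj f z) (1 - cnj g z)\<close> with \<open>l = u v w\<close>, together with one condition on the
  radius. Conversely each unimodular \<open>l\<close> gives a triangle, as all solutions of that equation are
  unimodular. Hence \<open>u + v + w = 2 m + l cnj (f g)\<close>. Since the circumcircle meets the ellipse in a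
  fourth point with parameter \<open>cnj l\<close>, the circumcenter is an affine function of
  \<open>u + v + w + cnj l\<close>, so it has the form \<open>Z\<^sub>0 + G l + H cnj l\<close>. This traces an ellipse with
  semi-axes \<open>|G| + |H|\<close> and \<open>||G| - |H||\<close> and foci \<open>Z\<^sub>0 \<plusminus> \<phi>\<close>, where \<open>\<phi>\<^sup>2 = 4 G H\<close>.
\<close>

section \<open>Tangent chords of the unit circle\<close>

text \<open>Vieta's formulas by divided differences: each subtraction of two equations releases a
  factor that distinctness cancels.\<close>

lemma cubic_coeffs_of_distinct_roots:
  fixes \<alpha> \<beta> \<gamma> :: "'a::idom"
  assumes "u \<noteq> v" "v \<noteq> w" "w \<noteq> u"
    and u: "u ^ 3 - \<alpha> * u\<^sup>2 + \<beta> * u - \<gamma> = 0"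
    and v: "v ^ 3 - \<alpha> * v\<^sup>2 + \<beta> * v - \<gamma> = 0"
    and w: "w ^ 3 - \<alpha> * w\<^sup>2 + \<beta> * w - \<gamma> = 0"
  shows "u + v + w = \<alpha>" "u * v + v * w + w * u = \<beta>"
proof -
  have "(u - v) * (u\<^sup>2 + u * v + v\<^sup>2 - \<alpha> * (u + v) + \<beta>) = 0"
    using u v by algebra
  hence uv: "u\<^sup>2 + u * v + v\<^sup>2 - \<alpha> * (u + v) + \<beta> = 0" using assms by simp
  have "(u - w) * (u\<^sup>2 + u * w + w\<^sup>2 - \<alpha> * (u + w) + \<beta>) = 0"
    using u w by algebra
  hence uw: "u\<^sup>2 + u * w + w\<^sup>2 - \<alpha> * (u + w) + \<beta> = 0" using assms by simp
  have "(v - w) * (u + v + w - \<alpha>) = 0" using uv uw by algebra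
  thus s: "u + v + w = \<alpha>" using assms by simp
  show "u * v + v * w + w * u = \<beta>" using uv s by algebra
qed

text \<open>For unimodular \<open>u\<close>, \<open>v\<close> the chord lies on the line
  \<open>z + u * v * cnj z = u + v\<close>. The value is \<open>4 * u * v\<close> times the squared
  distance of \<open>m\<close> from this line minus \<open>(h - \<sigma> * Re (u * v)) / 2\<close>,
  the squared half-width, in the direction normal to the chord, of the conic centred at
  \<open>m\<close>. At \<open>u = v\<close> the line becomes the tangent of the unit circle.\<close>

definition tangency :: "complex \<Rightarrow> real \<Rightarrow> real \<Rightarrow> complex \<Rightarrow> complex \<Rightarrow> complex" where
  "tangency m \<sigma> h u v = (m + u * v * cnj m - u - v)\<^sup>2 + \<sigma> * (1 + (u * v)\<^sup>2) - 2 * h * (u * v)"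

lemma tangency_commute: "tangency m \<sigma> h u v = tangency m \<sigma> h v u"
  by (simp add: tangency_def algebra_simps)

text \<open>For fixed \<open>u\<close> the tangency expression is a quadratic in the other endpoint
  with roots \<open>v\<close> and \<open>w\<close>, so \<open>v * w\<close> relates its constant and
  leading coefficients; \<open>h\<close> occurs only in the middle one. The extra factor
  \<open>u\<close> brings in the symmetric product \<open>u * v * w\<close>.\<close>

lemma tangency_imp_product:
  assumes "tangency m \<sigma> h u v = 0" "tangency m \<sigma> h u w = 0" "v \<noteq> w"
  shows "u * v * w * (1 - 2 * cnj m * u + ((cnj m)\<^sup>2 + \<sigma>) * u\<^sup>2) = u * (u\<^sup>2 - 2 * m * u + (m\<^sup>2 + \<sigma>))"
proof -
  have "(v - w) * (v * w * (1 - 2 * cnj m * u + ((cnj m)\<^sup>2 + \<sigma>) * u\<^sup>2) - (u\<^sup>2 - 2 * m * u + (m\<^sup>2 + \<sigma>))) = 0"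
    using assms(1,2) unfolding tangency_def by algebra
  hence "v * w * (1 - 2 * cnj m * u + ((cnj m)\<^sup>2 + \<sigma>) * u\<^sup>2) = u\<^sup>2 - 2 * m * u + (m\<^sup>2 + \<sigma>)"
    using assms(3) by (metis mult_eq_0_iff right_minus_eq)
  thus ?thesis by (metis mult.assoc)
qed

text \<open>All three vertices are roots of one monic cubic, whose coefficients involve the triangle
  only through \<open>u * v * w\<close>.\<close>

lemma triangle_elementary_symmetric:
  assumes d: "u \<noteq> v" "v \<noteq> w" "w \<noteq> u"
    and t: "tangency m \<sigma> h u v = 0" "tangency m \<sigma> h v w = 0" "tangency m \<sigma> h w u = 0"
  shows "u + v + w = 2 * m + u * v * w * ((cnj m)\<^sup>2 + \<sigma>)"
    and "u * v + v * w + w * u = m\<^sup>2 + \<sigma> + 2 * (u * v * w) * cnj m"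
proof -
  let ?\<alpha> = "2 * m + u * v * w * ((cnj m)\<^sup>2 + \<sigma>)"
  let ?\<beta> = "m\<^sup>2 + \<sigma> + 2 * (u * v * w) * cnj m"
  note t' = t[THEN trans[OF tangency_commute]]
  have "u ^ 3 - ?\<alpha> * u\<^sup>2 + ?\<beta> * u - u * v * w = 0"
    using tangency_imp_product[OF t(1) t'(3) d(2)] by algebra
  moreover have "v ^ 3 - ?\<alpha> * v\<^sup>2 + ?\<beta> * v - u * v * w = 0"
    using tangency_imp_product[OF t(2) t'(1) d(3)] by algebra
  moreover have "w ^ 3 - ?\<alpha> * w\<^sup>2 + ?\<beta> * w - u * v * w = 0"
    using tangency_imp_product[OF t(3) t'(2) d(1)] by algebra
  ultimately show "u + v + w = ?\<alpha>" "u * v + v * w + w * u = ?\<beta>"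
    using cubic_coeffs_of_distinct_roots[OF d] by blast+
qed

text \<open>Both relations are affine in \<open>w\<close>; cross-multiplying eliminates it and
  leaves the tangency expression up to a multiple of \<open>u * v\<close>. The factor is the same
  for every triangle, which is the porism: its vanishing is a condition on the radius alone.
  Distinctness is not assumed, so double roots are covered.\<close>

lemma tangency_eq_closure_defect:
  assumes "u + v + w = 2 * m + u * v * w * ((cnj m)\<^sup>2 + \<sigma>)"
    and "u * v + v * w + w * u = m\<^sup>2 + \<sigma> + 2 * (u * v * w) * cnj m"
  shows "tangency m \<sigma> h u v =
    u * v * of_real ((cmod (m\<^sup>2 + \<sigma>))\<^sup>2 - 2 * (cmod m)\<^sup>2 + 1 - 2 * h)"
proof -
  have k: "complex_of_real ((cmod (m\<^sup>2 + \<sigma>))\<^sup>2 - 2 * (cmod m)\<^sup>2 + 1 - 2 * h) =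
    (m\<^sup>2 + \<sigma>) * ((cnj m)\<^sup>2 + \<sigma>) - 2 * (m * cnj m) + 1 - 2 * complex_of_real h"
    by (simp add: complex_norm_square del: of_real_power)
  have a: "w * (1 - u * v * ((cnj m)\<^sup>2 + \<sigma>)) = 2 * m - (u + v)"
    and b: "w * ((u + v) - 2 * (u * v) * cnj m) = m\<^sup>2 + \<sigma> - u * v"
    using assms by (simp_all add: algebra_simps)
  have "(2 * m - (u + v)) * ((u + v) - 2 * (u * v) * cnj m) =
        (m\<^sup>2 + \<sigma> - u * v) * (1 - u * v * ((cnj m)\<^sup>2 + \<sigma>))"
    unfolding a[symmetric] b[symmetric] by (simp add: algebra_simps)
  thus ?thesis unfolding k tangency_def by algebra
qed

text \<open>The degenerate chord in real form, for excluding double roots later.\<close>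

lemma tangency_self:
  assumes u: "cmod u = 1"
  shows "tangency m \<sigma> h u u = u\<^sup>2 * of_real (4 * (1 - Re (m * cnj u))\<^sup>2 + 2 * \<sigma> * Re (u\<^sup>2) - 2 * h)"
proof -
  have i: "u * cnj u = 1" using u by (simp add: complex_norm_square[symmetric])
  have re: "2 * complex_of_real (Re z) = z + cnj z" for z using complex_add_cnj[of z] by simp
  have "complex_of_real (4 * (1 - Re (m * cnj u))\<^sup>2 + 2 * \<sigma> * Re (u\<^sup>2) - 2 * h) =
    (2 - 2 * complex_of_real (Re (m * cnj u)))\<^sup>2 + \<sigma> * (2 * complex_of_real (Re (u\<^sup>2))) - 2 * complex_of_real h"
    by (simp add: power2_eq_square algebra_simps)
  also have "\<dots> = (2 - (m * cnj u + cnj m * u))\<^sup>2 + \<sigma> * (u\<^sup>2 + (cnj u)\<^sup>2) - 2 * complex_of_real h"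
    unfolding re by simp
  finally have e: "complex_of_real (4 * (1 - Re (m * cnj u))\<^sup>2 + 2 * \<sigma> * Re (u\<^sup>2) - 2 * h) = \<dots>" .
  show ?thesis unfolding e tangency_def using i by algebra
qed

section \<open>Moebius factors and the Blaschke equation of degree three\<close>

lemma norm_moebius_identity:
  fixes f z :: complex
  shows "(cmod (z - f))\<^sup>2 - (cmod (1 - cnj f * z))\<^sup>2 = ((cmod z)\<^sup>2 - 1) * (1 - (cmod f)\<^sup>2)"
proof -
  have "complex_of_real ((cmod (z - f))\<^sup>2 - (cmod (1 - cnj f * z))\<^sup>2) =
        of_real (((cmod z)\<^sup>2 - 1) * (1 - (cmod f)\<^sup>2))"
    by (simp add: complex_norm_square algebra_simps del: of_real_power)
  thus ?thesis using of_real_eq_iff by blast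
qed

lemma norm_moebius_outside:
  assumes "cmod f < 1" "1 < cmod z"
  shows "cmod (1 - cnj f * z) < cmod (z - f)"
proof -
  have "0 < ((cmod z)\<^sup>2 - 1) * (1 - (cmod f)\<^sup>2)"
    using assms by (intro mult_pos_pos) (auto simp: power_less_one_iff one_less_power)
  thus ?thesis using norm_moebius_identity[of z f] by (intro power2_less_imp_less[of "cmod (1 - cnj f * z)"]) auto
qed

lemma norm_moebius_inside:
  assumes "cmod f < 1" "cmod z < 1"
  shows "cmod (z - f) < cmod (1 - cnj f * z)"
proof -
  have "0 < (1 - (cmod z)\<^sup>2) * (1 - (cmod f)\<^sup>2)"
    using assms by (intro mult_pos_pos) (auto simp: power_less_one_iff)
  hence "((cmod z)\<^sup>2 - 1) * (1 - (cmod f)\<^sup>2) < 0" by (simp add: algebra_simps)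
  thus ?thesis using norm_moebius_identity[of z f] by (intro power2_less_imp_less[of "cmod (z - f)"]) auto
qed

lemma norm_moebius_ge:
  assumes "cmod f < 1" "1 \<le> cmod z"
  shows "cmod (1 - cnj f * z) \<le> cmod (z - f)"
proof (cases "cmod z = 1")
  case True
  thus ?thesis using norm_moebius_identity[of z f] by simp
qed (use assms norm_moebius_outside[of f z] in auto)

text \<open>The ellipse with foci \<open>f\<close>, \<open>g\<close> and major axis
  \<open>cmod (1 - cnj f * g)\<close> thus stays inside the open disc. The number
  \<open>1 - cnj f * g\<close> splits into \<open>1 - cnj f * z\<close> and
  \<open>cnj f * (z - g)\<close>; strictness comes from \<open>cmod f < 1\<close> and
  \<open>z \<noteq> g\<close>.\<close>

lemma foci_sum_outside_disc:
  assumes f: "cmod f < 1" and g: "cmod g < 1" and z: "1 \<le> cmod z"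
  shows "cmod (1 - cnj f * g) < cmod (z - f) + cmod (z - g)"
proof -
  have "1 - cnj f * g = (1 - cnj f * z) + cnj f * (z - g)" by (simp add: algebra_simps)
  hence "cmod (1 - cnj f * g) \<le> cmod (1 - cnj f * z) + cmod f * cmod (z - g)"
    by (metis norm_triangle_ineq norm_mult complex_mod_cnj)
  also have "\<dots> < cmod (z - f) + cmod (z - g)"
  proof (rule add_le_less_mono)
    show "cmod (1 - cnj f * z) \<le> cmod (z - f)" by (rule norm_moebius_ge[OF f z])
    have "z \<noteq> g" using z g by auto
    thus "cmod f * cmod (z - g) < cmod (z - g)" using f by simp
  qed
  finally show ?thesis .
qed

text \<open>Off the unit circle the Moebius estimates, together with the factor \<open>z\<close>,
  make the moduli of the two sides strictly unequal.\<close>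

lemma blaschke_root_on_circle:
  assumes f: "cmod f < 1" and g: "cmod g < 1" and l: "cmod l = 1"
    and e: "z * (z - f) * (z - g) = l * (1 - cnj f * z) * (1 - cnj g * z)"
  shows "cmod z = 1"
proof -
  have e': "cmod z * (cmod (z - f) * cmod (z - g)) = cmod (1 - cnj f * z) * cmod (1 - cnj g * z)"
    using arg_cong[OF e, of cmod] l by (simp add: norm_mult mult.assoc)
  show ?thesis
  proof (rule linorder_cases[of "cmod z" 1])
    assume z: "cmod z < 1"
    have "cmod z * (cmod (z - f) * cmod (z - g)) \<le> 1 * (cmod (z - f) * cmod (z - g))"
      using z by (intro mult_right_mono) auto
    also have "\<dots> < cmod (1 - cnj f * z) * cmod (1 - cnj g * z)"
      using norm_moebius_inside[OF f z] norm_moebius_inside[OF g z]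
      by (simp add: mult_strict_mono')
    finally show ?thesis using e' by simp
  next
    assume z: "1 < cmod z"
    have "cmod (1 - cnj f * z) * cmod (1 - cnj g * z) < 1 * (cmod (z - f) * cmod (z - g))"
      using norm_moebius_outside[OF f z] norm_moebius_outside[OF g z]
      by (simp add: mult_strict_mono')
    also have "\<dots> \<le> cmod z * (cmod (z - f) * cmod (z - g))"
      using z by (intro mult_right_mono) auto
    finally show ?thesis using e' by simp
  qed
qed

lemma monic_quadratic_splits:
  fixes p q :: complex
  obtains v w where "v + w = p" "v * w = q"
proof
  define d where "d = csqrt (p\<^sup>2 - 4 * q)"
  have d: "d\<^sup>2 = p\<^sup>2 - 4 * q" by (simp add: d_def)
  show "(p + d) / 2 + (p - d) / 2 = p" by (simp add: field_simps)
  show "(p + d) / 2 * ((p - d) / 2) = q" using d by (simp add: field_simps power2_eq_square)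
qed

lemma monic_cubic_splits:
  fixes \<alpha> \<beta> \<gamma> :: complex
  obtains u v w where "u + v + w = \<alpha>" "u * v + v * w + w * u = \<beta>" "u * v * w = \<gamma>"
proof -
  have "\<exists>u. poly [:-\<gamma>, \<beta>, -\<alpha>, 1:] u = 0"
    by (rule fundamental_theorem_of_algebra_alt) auto
  then obtain u where u: "u ^ 3 - \<alpha> * u\<^sup>2 + \<beta> * u - \<gamma> = 0"
    by (auto simp: algebra_simps power2_eq_square power3_eq_cube)
  obtain v w where vw: "v + w = \<alpha> - u" "v * w = u\<^sup>2 - \<alpha> * u + \<beta>"
    by (rule monic_quadratic_splits)
  show ?thesis
  proof
    show "u + v + w = \<alpha>" using vw by (simp add: algebra_simps)
    show "u * v + v * w + w * u = \<beta>" using vw by algebra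
    show "u * v * w = \<gamma>" using vw u by algebra
  qed
qed

text \<open>Expanding the Blaschke equation gives a monic cubic with exactly these coefficients. Its
  roots are taken with multiplicity; that they are distinct is shown later.\<close>

lemma blaschke_fibre:
  assumes f: "cmod f < 1" and g: "cmod g < 1" and l: "cmod l = 1"
  obtains u v w where "cmod u = 1" "cmod v = 1" "cmod w = 1" "u * v * w = l"
    "u + v + w = f + g + l * cnj (f * g)" "u * v + v * w + w * u = f * g + l * cnj (f + g)"
proof -
  obtain u v w where e: "u + v + w = f + g + l * cnj (f * g)"
      "u * v + v * w + w * u = f * g + l * cnj (f + g)" "u * v * w = l"
    by (rule monic_cubic_splits)
  have "cmod z = 1" if "z \<in> {u, v, w}" for z
  proof (rule blaschke_root_on_circle[OF f g l])
    have "(z - u) * (z - v) * (z - w) = 0" using that by auto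
    hence "z ^ 3 - (u + v + w) * z\<^sup>2 + (u * v + v * w + w * u) * z - u * v * w = 0"
      by algebra
    thus "z * (z - f) * (z - g) = l * (1 - cnj f * z) * (1 - cnj g * z)"
      unfolding e by (simp add: algebra_simps power2_eq_square power3_eq_cube)
  qed
  thus ?thesis using that e by blast
qed

lemma cnj_unit_diff:
  assumes "cmod u = 1" "cmod v = 1"
  shows "u * v * cnj (u - v) = v - u"
proof -
  have "u * cnj u = 1" "v * cnj v = 1" using assms by (simp_all add: complex_norm_square[symmetric])
  thus ?thesis unfolding complex_cnj_diff by algebra
qed

section \<open>Triangles inscribed in the ellipse\<close>

lemma unique_root_iff_discriminant:
  fixes A B D :: real
  assumes "A > 0"
  shows "(\<exists>!t. A * t\<^sup>2 + 2 * B * t + D = 0) \<longleftrightarrow> B\<^sup>2 = A * D"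
proof
  assume "\<exists>!t. A * t\<^sup>2 + 2 * B * t + D = 0"
  then obtain t where t: "A * t\<^sup>2 + 2 * B * t + D = 0"
    and uni: "\<And>t'. A * t'\<^sup>2 + 2 * B * t' + D = 0 \<Longrightarrow> t' = t" by auto
  \<comment> \<open>\<open>- 2 * B / A - t\<close> is the second root by Vieta, so uniqueness makes
    the root double.\<close>
  have "A * (- 2 * B / A - t) = - 2 * B - A * t" using assms by (simp add: field_simps)
  hence "A * (A * (- 2 * B / A - t)\<^sup>2 + 2 * B * (- 2 * B / A - t) + D) = 0"
    using t by algebra
  hence "- 2 * B / A - t = t" using assms by (intro uni) simp
  hence "B = - A * t" using assms by (simp add: field_simps)
  thus "B\<^sup>2 = A * D" using t by algebra
next
  assume *: "B\<^sup>2 = A * D"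
  have "A * t\<^sup>2 + 2 * B * t + D = 0 \<longleftrightarrow> t = - B / A" for t
  proof -
    have "A * (A * t\<^sup>2 + 2 * B * t + D) = (A * t + B)\<^sup>2" using * by algebra
    hence "A * t\<^sup>2 + 2 * B * t + D = 0 \<longleftrightarrow> A * t + B = 0"
      using assms by (metis mult_eq_0_iff zero_eq_power2 less_irrefl)
    thus ?thesis using assms by (auto simp: field_simps)
  qed
  thus "\<exists>!t. A * t\<^sup>2 + 2 * B * t + D = 0" by simp
qed

text \<open>Tangency means that the quadratic in the line parameter has one root. Lagrange's
  identity rewrites its vanishing discriminant as squared cross product equal to squared radius
  times squared length.\<close>

lemma tangent_to_circle_iff:
  assumes "r > 0" "(p, p') \<noteq> (q, q')"
  shows "tangent_to_circle (x, y) r (p, p') (q, q') \<longleftrightarrow>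
    ((p - x) * (q' - p') - (p' - y) * (q - p))\<^sup>2 = r\<^sup>2 * ((q - p)\<^sup>2 + (q' - p')\<^sup>2)"
proof -
  let ?\<gamma> = "\<lambda>t::real. (p + t * (q - p), p' + t * (q' - p'))"
  let ?A = "(q - p)\<^sup>2 + (q' - p')\<^sup>2" and ?B = "(p - x) * (q - p) + (p' - y) * (q' - p')"
    and ?D = "(p - x)\<^sup>2 + (p' - y)\<^sup>2 - r\<^sup>2"
  have A: "?A > 0" using assms(2) by (auto simp: sum_power2_gt_zero_iff)
  have hull: "affine hull {(p, p'), (q, q')} = range ?\<gamma>"
    by (simp add: affine_hull_2_alt)
  have inj: "?\<gamma> s = ?\<gamma> t \<longleftrightarrow> s = t" for s t using assms(2) by auto
  have on: "?\<gamma> t \<in> sphere (x, y) r \<longleftrightarrow> ?A * t\<^sup>2 + 2 * ?B * t + ?D = 0" for t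
  proof -
    have "?\<gamma> t \<in> sphere (x, y) r \<longleftrightarrow> sqrt ((x - (p + t * (q - p)))\<^sup>2 + (y - (p' + t * (q' - p')))\<^sup>2) = r"
      by (simp add: dist_Pair_Pair dist_real_def)
    also have "\<dots> \<longleftrightarrow> (x - (p + t * (q - p)))\<^sup>2 + (y - (p' + t * (q' - p')))\<^sup>2 = r\<^sup>2"
      using assms(1) by (smt (verit, best) real_sqrt_unique real_sqrt_pow2 sum_power2_ge_zero)
    also have "\<dots> \<longleftrightarrow> ?A * t\<^sup>2 + 2 * ?B * t + ?D = 0"
      by (simp add: algebra_simps power2_eq_square)
    finally show ?thesis .
  qed
  have "tangent_to_circle (x, y) r (p, p') (q, q') \<longleftrightarrow> (\<exists>!t. ?\<gamma> t \<in> sphere (x, y) r)"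
  proof
    assume "tangent_to_circle (x, y) r (p, p') (q, q')"
    then obtain T where T: "range ?\<gamma> \<inter> sphere (x, y) r = {T}"
      unfolding tangent_to_circle_def hull by blast
    then obtain t where t: "T = ?\<gamma> t" by blast
    show "\<exists>!t. ?\<gamma> t \<in> sphere (x, y) r"
    proof
      show "?\<gamma> t \<in> sphere (x, y) r" using T t by blast
      fix s assume "?\<gamma> s \<in> sphere (x, y) r"
      hence "?\<gamma> s \<in> {T}" unfolding T[symmetric] by blast
      hence "?\<gamma> s = ?\<gamma> t" using t by blast
      thus "s = t" using inj by blast
    qed
  next
    assume "\<exists>!t. ?\<gamma> t \<in> sphere (x, y) r"
    then obtain t where "?\<gamma> t \<in> sphere (x, y) r" "\<And>s. ?\<gamma> s \<in> sphere (x, y) r \<Longrightarrow> s = t" by metis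
    hence "range ?\<gamma> \<inter> sphere (x, y) r = {?\<gamma> t}" by blast
    thus "tangent_to_circle (x, y) r (p, p') (q, q')"
      unfolding tangent_to_circle_def hull by blast
  qed
  also have "\<dots> \<longleftrightarrow> ?B\<^sup>2 = ?A * ?D"
    unfolding on by (rule unique_root_iff_discriminant[OF A])
  also have "\<dots> \<longleftrightarrow> ((p - x) * (q' - p') - (p' - y) * (q - p))\<^sup>2 = r\<^sup>2 * ?A"
  proof -
    have "((p - x) * (q' - p') - (p' - y) * (q - p))\<^sup>2 - r\<^sup>2 * ?A = ?A * ?D - ?B\<^sup>2" by algebra
    thus ?thesis by (metis eq_iff_diff_eq_0)
  qed
  finally show ?thesis .
qed

definition vertex :: "real \<Rightarrow> real \<Rightarrow> complex \<Rightarrow> point" where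
  "vertex a b u = (a * Re u, b * Im u)"

lemma vertex_inject:
  assumes "a \<noteq> 0" "b \<noteq> 0"
  shows "vertex a b u = vertex a b v \<longleftrightarrow> u = v"
  using assms by (simp add: vertex_def complex_eq_iff)

lemma ellipse_eq_image:
  assumes "a \<noteq> 0" "b \<noteq> 0"
  shows "ellipse a b = vertex a b ` {u. cmod u = 1}"
proof (intro set_eqI iffI)
  fix P assume "P \<in> ellipse a b"
  hence "(fst P / a)\<^sup>2 + (snd P / b)\<^sup>2 = 1"
    by (auto simp: ellipse_def power_divide)
  hence "cmod (Complex (fst P / a) (snd P / b)) = 1" by (simp add: cmod_def)
  moreover have "P = vertex a b (Complex (fst P / a) (snd P / b))"
    using assms by (simp add: vertex_def)
  ultimately show "P \<in> vertex a b ` {u. cmod u = 1}" by blast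
next
  fix P assume "P \<in> vertex a b ` {u. cmod u = 1}"
  then obtain u where "cmod u = 1" and P: "P = vertex a b u" by blast
  hence "(Re u)\<^sup>2 + (Im u)\<^sup>2 = 1" by (simp add: cmod_def)
  thus "P \<in> ellipse a b" using assms
    by (simp add: P vertex_def ellipse_def power_mult_distrib)
qed

text \<open>On the unit circle \<open>u * v * cnj (v - u) = u - v\<close>, so a multiple of
  \<open>u * v\<close> clears every conjugate except \<open>cnj m\<close>, and the real distance
  condition becomes the polynomial one.\<close>

lemma chord_distance_eq_tangency:
  assumes u: "cmod u = 1" and v: "cmod v = 1"
  shows "4 * (u * v)\<^sup>2 * of_real ((Im (cnj (u - m) * (v - u)))\<^sup>2
      - h / 2 * (cmod (v - u))\<^sup>2 - \<sigma> / 2 * Re ((v - u)\<^sup>2)) = - (v - u)\<^sup>2 * tangency m \<sigma> h u v"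
proof -
  define d d' z z' where "d = v - u" and "d' = cnj (v - u)"
    and "z = cnj (u - m) * (v - u)" and "z' = (u - m) * cnj (v - u)"
  have d': "u * v * d' = - d" unfolding d_def d'_def using cnj_unit_diff[OF v u] by (simp add: mult.commute)
  have z': "u * v * z' = - (u - m) * d"
    using d' unfolding z'_def d'_def by algebra
  have z: "u * v * z = (v - u * v * cnj m) * d"
  proof -
    have "u * cnj u = 1" using u by (simp add: complex_norm_square[symmetric])
    thus ?thesis unfolding z_def d_def complex_cnj_diff by algebra
  qed
  have im: "(of_real (Im z))\<^sup>2 = - (z - z')\<^sup>2 / 4"
  proof -
    have "z' = cnj z" by (simp add: z_def z'_def)
    hence "z - z' = 2 * of_real (Im z) * \<i>" by (simp add: complex_diff_cnj)
    thus ?thesis by (simp add: power_mult_distrib)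
  qed
  have re: "complex_of_real (Re (d\<^sup>2)) = (d\<^sup>2 + d'\<^sup>2) / 2"
    using complex_add_cnj[of "d\<^sup>2"] by (simp add: d_def d'_def)
  have n: "complex_of_real ((cmod d)\<^sup>2) = d * d'"
    by (simp add: d_def d'_def complex_norm_square del: of_real_power)
  have "4 * (u * v)\<^sup>2 * of_real ((Im z)\<^sup>2 - h / 2 * (cmod d)\<^sup>2 - \<sigma> / 2 * Re (d\<^sup>2)) =
    - (u * v * z - u * v * z')\<^sup>2 - 2 * h * u * v * d * (u * v * d') - \<sigma> * ((u * v * d)\<^sup>2 + (u * v * d')\<^sup>2)"
    unfolding of_real_diff of_real_mult re n unfolding of_real_power im
    by (simp add: field_simps power2_eq_square)
  also have "\<dots> = - d\<^sup>2 * tangency m \<sigma> h u v"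
    unfolding d' z z' tangency_def by (simp add: algebra_simps power2_eq_square)
  finally show ?thesis by (simp add: d_def z_def)
qed

text \<open>The scaled circle has semi-axes \<open>r / a\<close> and \<open>r / b\<close>;
  \<open>h\<close> is the sum of their squares and \<open>\<sigma>\<close> the difference. Scaling
  back puts the factor \<open>(a * b)^2\<close> on both sides of the metric condition.\<close>

lemma tangent_chord_iff:
  assumes ab: "a > 0" "b > 0" and r: "r > 0" and u: "cmod u = 1" and v: "cmod v = 1" and "u \<noteq> v"
    and \<sigma>: "\<sigma> = r\<^sup>2 * (1 / b\<^sup>2 - 1 / a\<^sup>2)" and h: "h = r\<^sup>2 * (1 / a\<^sup>2 + 1 / b\<^sup>2)"
  shows "tangent_to_circle (vertex a b m) r (vertex a b u) (vertex a b v) \<longleftrightarrow> tangency m \<sigma> h u v = 0"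
proof -
  have ne: "(a * Re u, b * Im u) \<noteq> (a * Re v, b * Im v)"
    using vertex_inject[of a b u v] ab \<open>u \<noteq> v\<close> by (auto simp: vertex_def)
  have 1: "((a * Re u - a * Re m) * (b * Im v - b * Im u) - (b * Im u - b * Im m) * (a * Re v - a * Re u))\<^sup>2
    = (a * b)\<^sup>2 * (Im (cnj (u - m) * (v - u)))\<^sup>2"
    by (simp add: algebra_simps power2_eq_square)
  have 2: "r\<^sup>2 * ((a * Re v - a * Re u)\<^sup>2 + (b * Im v - b * Im u)\<^sup>2)
    = (a * b)\<^sup>2 * (h / 2 * (cmod (v - u))\<^sup>2 + \<sigma> / 2 * Re ((v - u)\<^sup>2))"
    unfolding \<sigma> h cmod_power2 using ab by (simp add: field_simps power2_eq_square)
  have "tangent_to_circle (vertex a b m) r (vertex a b u) (vertex a b v) \<longleftrightarrow>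
    (Im (cnj (u - m) * (v - u)))\<^sup>2 = h / 2 * (cmod (v - u))\<^sup>2 + \<sigma> / 2 * Re ((v - u)\<^sup>2)"
    unfolding vertex_def tangent_to_circle_iff[OF r ne] 1 2 using ab by simp
  also have "\<dots> \<longleftrightarrow> complex_of_real ((Im (cnj (u - m) * (v - u)))\<^sup>2
      - h / 2 * (cmod (v - u))\<^sup>2 - \<sigma> / 2 * Re ((v - u)\<^sup>2)) = 0"
    unfolding of_real_eq_0_iff by (auto simp: algebra_simps)
  also have "\<dots> \<longleftrightarrow> tangency m \<sigma> h u v = 0"
  proof -
    have "u \<noteq> 0" "v \<noteq> 0" using u v by auto
    thus ?thesis using chord_distance_eq_tangency[OF u v, of m h \<sigma>] \<open>u \<noteq> v\<close>
      by (metis (no_types, lifting) mult_eq_0_iff neg_equal_0_iff_equal power_not_zero right_minus_eq zero_neq_numeral)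
  qed
  finally show ?thesis .
qed

text \<open>If \<open>w - u\<close> is a real multiple of \<open>v - u\<close>, conjugation on the
  unit circle yields a second relation with the same ratio; together they force \<open>w = v\<close>
  or \<open>w = u\<close>.\<close>

lemma not_collinear_vertices:
  assumes ab: "a > 0" "b > 0" and n: "cmod u = 1" "cmod v = 1" "cmod w = 1"
    and d: "u \<noteq> v" "v \<noteq> w" "w \<noteq> u"
  shows "\<not> collinear {vertex a b u, vertex a b v, vertex a b w}"
proof
  assume "collinear {vertex a b u, vertex a b v, vertex a b w}"
  hence "collinear {vertex a b v, vertex a b u, vertex a b w}" by (simp add: insert_commute)
  hence "collinear {0, vertex a b v - vertex a b u, vertex a b w - vertex a b u}"
    using collinear_3[of "vertex a b v" "vertex a b u" "vertex a b w"] by simp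
  moreover have "vertex a b v - vertex a b u \<noteq> 0" "vertex a b w - vertex a b u \<noteq> 0"
    using vertex_inject[of a b] ab d by auto
  ultimately obtain t where t: "vertex a b w - vertex a b u = t *\<^sub>R (vertex a b v - vertex a b u)"
    using collinear_lemma by blast
  have "Re (w - u) = t * Re (v - u)" "Im (w - u) = t * Im (v - u)"
    using t ab by (simp_all add: vertex_def algebra_simps) (metis distrib_left mult.left_commute mult_left_cancel order_less_irrefl)+
  hence e: "w - u = t * (v - u)" by (simp add: complex_eq_iff)
  have "cnj (w - u) = t * cnj (v - u)" using arg_cong[OF e, of cnj] by simp
  hence "v * (u - w) = t * w * (u - v)"
    using cnj_unit_diff[OF n(3,1)] cnj_unit_diff[OF n(2,1)] by algebra
  hence "(w - v) * (w - u) = 0" using e by algebra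
  thus False using d by auto
qed

section \<open>Circumcenters of inscribed triangles\<close>

lemma vertex_dist_eq:
  assumes u: "cmod u = 1"
  shows "(dist (x, y) (vertex a b u))\<^sup>2 = x\<^sup>2 + y\<^sup>2 + (a\<^sup>2 + b\<^sup>2) / 2
     + (a\<^sup>2 - b\<^sup>2) / 2 * Re (u\<^sup>2) - 2 * Re (Complex (a * x) (- b * y) * u)"
proof -
  have 1: "(Re u)\<^sup>2 + (Im u)\<^sup>2 = 1" using u by (simp add: cmod_def)
  have "(dist (x, y) (vertex a b u))\<^sup>2 = (x - a * Re u)\<^sup>2 + (y - b * Im u)\<^sup>2"
    by (simp add: vertex_def dist_Pair_Pair dist_real_def)
  also have "\<dots> = x\<^sup>2 + y\<^sup>2 + (a\<^sup>2 + b\<^sup>2) / 2 * ((Re u)\<^sup>2 + (Im u)\<^sup>2)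
     + (a\<^sup>2 - b\<^sup>2) / 2 * ((Re u)\<^sup>2 - (Im u)\<^sup>2) - 2 * (a * x * Re u + b * y * Im u)"
    by (simp add: field_simps power2_eq_square)
  finally show ?thesis using 1 by (simp add: power2_eq_square)
qed

text \<open>Multiplied by \<open>(u * v)^2\<close>, the difference of the squared distances has the
  factor \<open>u - v\<close>. The cofactor is linear in \<open>V\<close> and \<open>cnj V\<close>,
  where \<open>V\<close> encodes the candidate centre.\<close>

lemma equidistant_iff:
  fixes a b x y :: real
  defines "V \<equiv> Complex (a * x) (- b * y)" and "\<kappa> \<equiv> (a\<^sup>2 - b\<^sup>2) / 4"
  assumes u: "cmod u = 1" and v: "cmod v = 1" and d: "u \<noteq> v"
  shows "dist (x, y) (vertex a b u) = dist (x, y) (vertex a b v) \<longleftrightarrow>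
    V * (u * v)\<^sup>2 - cnj V * (u * v) = \<kappa> * (u + v) * ((u * v)\<^sup>2 - 1)"
proof -
  define E where "E = 2 * \<kappa> * Re (u\<^sup>2) - 2 * Re (V * u) - (2 * \<kappa> * Re (v\<^sup>2) - 2 * Re (V * v))"
  have "dist (x, y) (vertex a b u) = dist (x, y) (vertex a b v) \<longleftrightarrow>
      (dist (x, y) (vertex a b u))\<^sup>2 = (dist (x, y) (vertex a b v))\<^sup>2"
    by (simp add: power2_eq_iff_nonneg)
  also have "\<dots> \<longleftrightarrow> E = 0"
  proof -
    have "2 * \<kappa> = (a\<^sup>2 - b\<^sup>2) / 2" by (simp add: \<kappa>_def)
    note E_def[unfolded this V_def]
    thus ?thesis unfolding vertex_dist_eq[OF u] vertex_dist_eq[OF v] by linarith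
  qed
  also have "\<dots> \<longleftrightarrow> (u * v)\<^sup>2 * complex_of_real E = 0"
    using u v by auto
  also have "(u * v)\<^sup>2 * complex_of_real E =
     (u - v) * (\<kappa> * (u + v) * ((u * v)\<^sup>2 - 1) - (V * (u * v)\<^sup>2 - cnj V * (u * v)))"
  proof -
    have re: "2 * complex_of_real (Re z) = z + cnj z" for z
      using complex_add_cnj[of z] by simp
    have "complex_of_real E = \<kappa> * (2 * complex_of_real (Re (u\<^sup>2))) - 2 * complex_of_real (Re (V * u))
       - (\<kappa> * (2 * complex_of_real (Re (v\<^sup>2))) - 2 * complex_of_real (Re (V * v)))"
      by (simp add: E_def)
    also have "\<dots> = \<kappa> * (u\<^sup>2 - v\<^sup>2 + (cnj u + cnj v) * (cnj u - cnj v)) - (V * (u - v) + cnj V * (cnj u - cnj v))"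
      unfolding re by (simp add: algebra_simps power2_eq_square)
    finally have E: "complex_of_real E = \<dots>" .
    have "u * v * (cnj u - cnj v) = v - u" using cnj_unit_diff[OF u v] by simp
    moreover have "u * v * (cnj u + cnj v) = u + v"
    proof -
      have "u * cnj u = 1" "v * cnj v = 1" using u v by (simp_all add: complex_norm_square[symmetric])
      thus ?thesis by algebra
    qed
    ultimately show ?thesis unfolding E by algebra
  qed
  also have "\<dots> = 0 \<longleftrightarrow> V * (u * v)\<^sup>2 - cnj V * (u * v) = \<kappa> * (u + v) * ((u * v)\<^sup>2 - 1)"
    using d by (metis mult_eq_0_iff right_minus_eq)
  finally show ?thesis .
qed

text \<open>Fixing the distance from the centre to a point of the ellipse gives a quartic in the
  parameter, with outer coefficients \<open>\<kappa>\<close> and cubic coefficient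
  \<open>- V\<close>. For \<open>\<kappa> \<noteq> 0\<close> its roots have product 1 and sum
  \<open>V / \<kappa>\<close>, so the fourth root is \<open>cnj (u * v * w)\<close>; this explains
  the formula.\<close>

lemma circumcenter_vertices:
  assumes ab: "a \<noteq> 0" "b \<noteq> 0" and n: "cmod u = 1" "cmod v = 1" "cmod w = 1"
    and d: "u \<noteq> v" "v \<noteq> w" "w \<noteq> u"
    and V: "V = (a\<^sup>2 - b\<^sup>2) / 4 * (u + v + w + cnj (u * v * w))"
  shows "circumcenter (vertex a b u, vertex a b v, vertex a b w) = (Re V / a, - Im V / b)"
proof -
  define \<kappa> where "\<kappa> = (a\<^sup>2 - b\<^sup>2) / 4"
  have inv: "u * cnj u = 1" "v * cnj v = 1" "w * cnj w = 1"
    using n by (simp_all add: complex_norm_square[symmetric])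
  have V': "V = \<kappa> * (u + v + w + cnj u * cnj v * cnj w)"
    "cnj V = \<kappa> * (cnj u + cnj v + cnj w + u * v * w)"
    by (simp_all add: V \<kappa>_def)
  have V1: "V * (u * v) - cnj V = \<kappa> * (u + v) * (u * v - cnj u * cnj v)"
    using inv V' by algebra
  have V2: "V * (v * w) - cnj V = \<kappa> * (v + w) * (v * w - cnj v * cnj w)"
    using inv V' by algebra
  have eqd: "dist X (vertex a b u) = dist X (vertex a b v) \<and> dist X (vertex a b v) = dist X (vertex a b w)
    \<longleftrightarrow> Complex (a * fst X) (- b * snd X) = V" for X
  proof -
    define U where "U = Complex (a * fst X) (- b * snd X)"
    have X: "X = (fst X, snd X)" by simp
    have "dist X (vertex a b u) = dist X (vertex a b v) \<and> dist X (vertex a b v) = dist X (vertex a b w)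
      \<longleftrightarrow> U * (u * v)\<^sup>2 - cnj U * (u * v) = \<kappa> * (u + v) * ((u * v)\<^sup>2 - 1)
       \<and> U * (v * w)\<^sup>2 - cnj U * (v * w) = \<kappa> * (v + w) * ((v * w)\<^sup>2 - 1)"
      using equidistant_iff[OF n(1,2) d(1), of "fst X" "snd X" a b]
        equidistant_iff[OF n(2,3) d(2), of "fst X" "snd X" a b]
      unfolding U_def \<kappa>_def by simp
    also have "\<dots> \<longleftrightarrow> U = V"
    proof
      assume UV: "U = V"
      show "U * (u * v)\<^sup>2 - cnj U * (u * v) = \<kappa> * (u + v) * ((u * v)\<^sup>2 - 1)
       \<and> U * (v * w)\<^sup>2 - cnj U * (v * w) = \<kappa> * (v + w) * ((v * w)\<^sup>2 - 1)"
        unfolding UV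
      proof
        show "V * (u * v)\<^sup>2 - cnj V * (u * v) = \<kappa> * (u + v) * ((u * v)\<^sup>2 - 1)"
          using V1 inv(1,2) by algebra
        show "V * (v * w)\<^sup>2 - cnj V * (v * w) = \<kappa> * (v + w) * ((v * w)\<^sup>2 - 1)"
          using V2 inv(2,3) by algebra
      qed
    next
      assume *: "U * (u * v)\<^sup>2 - cnj U * (u * v) = \<kappa> * (u + v) * ((u * v)\<^sup>2 - 1)
       \<and> U * (v * w)\<^sup>2 - cnj U * (v * w) = \<kappa> * (v + w) * ((v * w)\<^sup>2 - 1)"
      have "U * (u * v) - cnj U = \<kappa> * (u + v) * (u * v - cnj u * cnj v)"
        using * inv by algebra
      moreover have "U * (v * w) - cnj U = \<kappa> * (v + w) * (v * w - cnj v * cnj w)"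
        using * inv by algebra
      \<comment> \<open>Subtracting the two conditions removes \<open>cnj U\<close> and
        \<open>cnj V\<close>, which gives uniqueness.\<close>
      ultimately have "v * (u - w) * (U - V) = 0"
        using V1 V2 inv by algebra
      thus "U = V" using d n by auto
    qed
    finally show ?thesis unfolding U_def .
  qed
  have "Complex (a * fst X) (- b * snd X) = V \<longleftrightarrow> X = (Re V / a, - Im V / b)" for X
    using ab by (cases X) (auto simp: complex_eq_iff field_simps)
  thus ?thesis unfolding circumcenter_def by (simp add: eqd)
qed

text \<open>Coefficients are written as squares so that the foci are polynomial: for unimodular
  \<open>l\<close>, the differences to the foci are \<open>cnj l * (g * l - h)^2\<close> and
  \<open>cnj l * (g * l + h)^2\<close>, and the parallelogram law gives their constant sum of
  moduli. Conversely, every \<open>Z\<close> is the image of some \<open>l\<close>, and the focal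
  sum decides whether \<open>l\<close> is unimodular.\<close>

lemma ellipse_param:
  fixes g h :: complex
  assumes ne: "cmod g \<noteq> cmod h"
  shows "{Z. cmod (Z - 2 * g * h) + cmod (Z + 2 * g * h) = 2 * ((cmod g)\<^sup>2 + (cmod h)\<^sup>2)}
    = (\<lambda>l. g\<^sup>2 * l + h\<^sup>2 * cnj l) ` {l. cmod l = 1}"
proof -
  define S where "S Z = cmod (Z - 2 * g * h) + cmod (Z + 2 * g * h)" for Z
  define A where "A = (cmod g)\<^sup>2 + (cmod h)\<^sup>2"
  have on: "S (g\<^sup>2 * l + h\<^sup>2 * cnj l) = 2 * A" if l: "cmod l = 1" for l
  proof -
    have l1: "l * cnj l = 1" using l by (simp add: complex_norm_square[symmetric])
    have "g\<^sup>2 * l + h\<^sup>2 * cnj l - 2 * g * h = cnj l * (g * l - h)\<^sup>2"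
      "g\<^sup>2 * l + h\<^sup>2 * cnj l + 2 * g * h = cnj l * (g * l + h)\<^sup>2" using l1 by algebra+
    hence "S (g\<^sup>2 * l + h\<^sup>2 * cnj l) = (cmod (g * l - h))\<^sup>2 + (cmod (g * l + h))\<^sup>2"
      using l by (simp add: S_def norm_mult norm_power)
    also have "\<dots> = 2 * ((cmod (g * l))\<^sup>2 + (cmod h)\<^sup>2)"
      unfolding cmod_power2 by (simp add: power2_eq_square algebra_simps)
    finally show ?thesis using l by (simp add: A_def norm_mult)
  qed
  have foc: "2 * cmod (2 * g * h) < 2 * A"
  proof -
    have "0 < (cmod g - cmod h)\<^sup>2" using ne by simp
    thus ?thesis by (simp add: A_def norm_mult power2_eq_square algebra_simps)
  qed
  \<comment> \<open>\<open>S\<close> is convex and at \<open>0\<close> below \<open>2 * A\<close>, so every ray from \<open>0\<close> takes the value \<open>2 * A\<close> only once.\<close>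
  have shrink: "S (t *\<^sub>R Z) < 2 * A" if "S Z = 2 * A" "0 \<le> t" "t < 1" for t Z
  proof -
    let ?\<phi> = "2 * g * h"
    have "t *\<^sub>R Z - ?\<phi> = t *\<^sub>R (Z - ?\<phi>) + (1 - t) *\<^sub>R (- ?\<phi>)"
         "t *\<^sub>R Z + ?\<phi> = t *\<^sub>R (Z + ?\<phi>) + (1 - t) *\<^sub>R ?\<phi>" by (simp_all add: algebra_simps)
    hence "S (t *\<^sub>R Z) \<le> (norm (t *\<^sub>R (Z - ?\<phi>)) + norm ((1 - t) *\<^sub>R (- ?\<phi>)))
      + (norm (t *\<^sub>R (Z + ?\<phi>)) + norm ((1 - t) *\<^sub>R ?\<phi>))"
      unfolding S_def by (metis add_mono norm_triangle_ineq)
    also have "\<dots> = t * S Z + (1 - t) * (2 * cmod ?\<phi>)"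
      unfolding norm_scaleR norm_minus_cancel S_def using that(2,3) by (simp add: algebra_simps)
    also have "\<dots> < t * (2 * A) + (1 - t) * (2 * A)"
      using that foc by (intro add_le_less_mono mult_strict_left_mono) auto
    finally show ?thesis by (simp add: algebra_simps)
  qed
  have "Z \<in> (\<lambda>l. g\<^sup>2 * l + h\<^sup>2 * cnj l) ` {l. cmod l = 1}" if Z: "S Z = 2 * A" for Z
  proof -
    define D where "D = (cmod g) ^ 4 - (cmod h) ^ 4"
    have D0: "D \<noteq> 0" using ne unfolding D_def by (metis norm_ge_zero power_eq_iff_eq_base right_minus_eq zero_less_numeral)
    \<comment> \<open>Inverse of the real-linear map, whose determinant is \<open>D\<close>.\<close>
    define l where "l = (cnj (g\<^sup>2) * Z - h\<^sup>2 * cnj Z) / D"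
    have D: "complex_of_real D = g\<^sup>2 * cnj (g\<^sup>2) - h\<^sup>2 * cnj (h\<^sup>2)"
      unfolding D_def complex_norm_square[symmetric] norm_power by simp
    have Dl: "D * l = cnj (g\<^sup>2) * Z - h\<^sup>2 * cnj Z" using D0 by (simp add: l_def)
    have Dl': "D * cnj l = g\<^sup>2 * cnj Z - cnj (h\<^sup>2) * Z" using arg_cong[OF Dl, of cnj] by simp
    have "D * (g\<^sup>2 * l + h\<^sup>2 * cnj l) = g\<^sup>2 * (D * l) + h\<^sup>2 * (D * cnj l)" by (simp add: algebra_simps)
    also have "\<dots> = D * Z" unfolding Dl Dl' unfolding D by (simp add: algebra_simps)
    finally have Zl: "Z = g\<^sup>2 * l + h\<^sup>2 * cnj l" using D0 by simp
    have "cmod l = 1"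
    proof (rule ccontr)
      assume l1: "cmod l \<noteq> 1"
      \<comment> \<open>The direction of \<open>l\<close>; the default 1 keeps \<open>q\<close>
        unimodular when \<open>l = 0\<close>, where the ray argument runs with factor 0.\<close>
      define q where "q = (if l = 0 then 1 else sgn l)"
      have q: "cmod q = 1" by (simp add: q_def norm_sgn)
      have lq: "l = cmod l *\<^sub>R q" by (simp add: q_def sgn_div_norm)
      define Q where "Q = g\<^sup>2 * q + h\<^sup>2 * cnj q"
      have ZQ: "Z = cmod l *\<^sub>R Q" unfolding Zl Q_def
        by (subst (1 2) lq) (simp add: scaleR_conv_of_real algebra_simps)
      show False
      proof (cases "cmod l < 1")
        case True
        thus False using shrink[of Q "cmod l"] on[OF q] Z ZQ by (simp add: Q_def)
      next
        case False
        hence "1 < cmod l" using l1 by simp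
        hence "1 / cmod l < 1" "Q = (1 / cmod l) *\<^sub>R Z"
          unfolding ZQ by (auto simp: divide_less_eq)
        thus False using shrink[of Z "1 / cmod l"] on[OF q] Z by (simp add: Q_def)
      qed
    qed
    thus ?thesis using Zl by blast
  qed
  thus ?thesis using on unfolding S_def A_def by blast
qed

section \<open>The family with a given incenter\<close>

text \<open>The scaled circle is an ellipse with vertical major axis \<open>2 * r / b\<close> and
  foci \<open>m \<plusminus> \<i> * s\<close>; by \<open>major\<close> this length is the bound of
  \<open>foci_sum_outside_disc\<close>.\<close>

lemma circle_in_ellipse_interior_of_foci:
  fixes a b r s :: real
  assumes ab: "a > b" "b > 0" and r: "r > 0" and s: "s\<^sup>2 = r\<^sup>2 * (1 / b\<^sup>2 - 1 / a\<^sup>2)" "s > 0"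
    and f: "cmod (m + \<i> * s) < 1" and g: "cmod (m - \<i> * s) < 1"
    and major: "cmod (1 - cnj (m + \<i> * s) * (m - \<i> * s)) = 2 * r / b"
  shows "sphere (vertex a b m) r \<subseteq> ellipse_interior a b"
proof
  fix P assume "P \<in> sphere (vertex a b m) r"
  hence dP: "dist (vertex a b m) P = r" by simp
  define z where "z = Complex (fst P / a) (snd P / b)"
  define p q where "p = Re z - Re m" and "q = Im z - Im m"
  have P: "P = vertex a b z" using ab by (simp add: z_def vertex_def)
  have "r\<^sup>2 = (a * Re m - a * Re z)\<^sup>2 + (b * Im m - b * Im z)\<^sup>2"
    unfolding dP[symmetric] by (simp add: P vertex_def dist_Pair_Pair dist_real_def)
  hence pq: "r\<^sup>2 = a\<^sup>2 * p\<^sup>2 + b\<^sup>2 * q\<^sup>2" unfolding p_def q_def by algebra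
  have "a * b * s = r * sqrt (a\<^sup>2 - b\<^sup>2)"
  proof (rule power2_eq_imp_eq)
    have "(a * b * s)\<^sup>2 = r\<^sup>2 * (a\<^sup>2 - b\<^sup>2)"
      unfolding power_mult_distrib s(1) using ab by (simp add: field_simps)
    thus "(a * b * s)\<^sup>2 = (r * sqrt (a\<^sup>2 - b\<^sup>2))\<^sup>2"
      using ab by (simp add: power_mult_distrib power_mono)
  qed (use ab r s in \<open>auto simp: power_mono\<close>)
  define c where "c = sqrt (a\<^sup>2 - b\<^sup>2)"
  have c2: "c\<^sup>2 = a\<^sup>2 - b\<^sup>2" using ab by (simp add: c_def power_mono)
  have c0: "0 \<le> c" using ab by (simp add: c_def power_mono)
  have ca: "c < a" by (rule power2_less_imp_less) (use ab c2 in auto)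
  have sc: "s = r * c / (a * b)" using \<open>a * b * s = _\<close> ab by (simp add: c_def field_simps)
  have "(b * q)\<^sup>2 \<le> r\<^sup>2" using pq by (simp add: power_mult_distrib)
  hence bq: "\<bar>b * q\<bar> \<le> r" using r by (simp add: abs_le_square_iff[symmetric])
  have cq: "\<bar>q * c / a\<bar> \<le> r / b"
  proof -
    have "\<bar>q\<bar> * b * c \<le> r * a"
      using bq ca c0 ab r by (intro mult_mono) (auto simp: abs_mult mult.commute)
    thus ?thesis using ab c0 by (simp add: abs_mult field_simps)
  qed
  \<comment> \<open>The squared focal distances are squares of forms linear in \<open>q\<close>; by
    \<open>cq\<close> these forms are nonnegative, so the distances add up to
    \<open>2 * r / b\<close>.\<close>
  have 1: "p\<^sup>2 + (q - s)\<^sup>2 = (r / b - q * c / a)\<^sup>2" and 2: "p\<^sup>2 + (q + s)\<^sup>2 = (r / b + q * c / a)\<^sup>2"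
  proof -
    have "a\<^sup>2 * b\<^sup>2 * (p\<^sup>2 + (q + t * s)\<^sup>2) = a\<^sup>2 * b\<^sup>2 * (r / b + t * (q * c / a))\<^sup>2" if t: "t\<^sup>2 = 1" for t
    proof -
      have e: "a * b * s = r * c" "a * b * (r / b) = a * r" "a * b * (q * c / a) = b * q * c"
        using sc ab by (auto simp: field_simps)
      have "a\<^sup>2 * b\<^sup>2 * (p\<^sup>2 + (q + t * s)\<^sup>2) = b\<^sup>2 * (r\<^sup>2 - b\<^sup>2 * q\<^sup>2) + (a * b * q + t * (a * b * s))\<^sup>2"
        using pq by algebra
      also have "\<dots> = (a * b * (r / b) + t * (a * b * (q * c / a)))\<^sup>2"
        unfolding e using c2 t by algebra
      also have "\<dots> = a\<^sup>2 * b\<^sup>2 * (r / b + t * (q * c / a))\<^sup>2" by algebra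
      finally show ?thesis .
    qed
    from this[of 1] this[of "-1"] show "p\<^sup>2 + (q - s)\<^sup>2 = (r / b - q * c / a)\<^sup>2" "p\<^sup>2 + (q + s)\<^sup>2 = (r / b + q * c / a)\<^sup>2"
      using ab by auto
  qed
  have "cmod (z - (m + \<i> * s)) = sqrt (p\<^sup>2 + (q - s)\<^sup>2)" "cmod (z - (m - \<i> * s)) = sqrt (p\<^sup>2 + (q + s)\<^sup>2)"
    by (simp_all add: cmod_def p_def q_def algebra_simps)
  hence "cmod (z - (m + \<i> * s)) + cmod (z - (m - \<i> * s)) = 2 * r / b"
    unfolding 1 2 using cq by (simp add: abs_le_iff)
  hence "cmod z < 1"
    using foci_sum_outside_disc[OF f g, of z] major by force
  hence "(Re z)\<^sup>2 + (Im z)\<^sup>2 < 1"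
    unfolding cmod_power2[symmetric] by (simp add: power_less_one_iff)
  thus "P \<in> ellipse_interior a b"
    unfolding ellipse_interior_def z_def by (auto simp: power_divide split: prod.split)
qed

text \<open>The pair \<open>\<xi>\<close>, \<open>\<eta>\<close> is the incenter in scaled
  coordinates; \<open>d\<close>, \<open>d'\<close> stand for \<open>\<delta>\<^sub>3\<close>,
  \<open>\<delta>\<^sub>3'\<close>. They enter through their squares and signs, so that the
  identities are polynomial.\<close>

locale incircle_family =
  fixes a b \<xi> \<eta> d d' :: real
  assumes a_gt_b: "a > b" and b_pos: "b > 0" and inside: "\<xi>\<^sup>2 + \<eta>\<^sup>2 < 1"
    and d_pos: "d > 0" and d'_pos: "d' > 0"
    and d_sq: "4 * d\<^sup>2 = b\<^sup>2 + (a\<^sup>2 - b\<^sup>2) * \<eta>\<^sup>2"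
    and d'_sq: "4 * d'\<^sup>2 = a\<^sup>2 - (a\<^sup>2 - b\<^sup>2) * \<xi>\<^sup>2"
begin

text \<open>
  The incircle has radius \<open>a b \<tau>\<close>; scaled, it becomes an ellipse with center \<open>m\<close> and foci
  \<open>m \<plusminus> \<i> sqrt \<sigma>\<close>, whose product is \<open>k\<close>.
\<close>

definition "e = a\<^sup>2 - b\<^sup>2"
definition "m = Complex \<xi> \<eta>"
definition "\<tau> = 2 * (d' - d) / e"
definition "\<sigma> = \<tau>\<^sup>2 * e"
definition "k = m\<^sup>2 + complex_of_real \<sigma>"

lemma a_pos: "a > 0" using a_gt_b b_pos by simp

lemma e_pos: "e > 0"
  using a_gt_b b_pos by (simp add: e_def power_strict_mono)

lemma sq_diff: "4 * (d'\<^sup>2 - d\<^sup>2) = e * (1 - (\<xi>\<^sup>2 + \<eta>\<^sup>2))"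
  using d_sq d'_sq by (simp add: e_def algebra_simps)

lemma d_less: "d < d'"
proof -
  have "0 < e * (1 - (\<xi>\<^sup>2 + \<eta>\<^sup>2))" using e_pos inside by simp
  hence "d\<^sup>2 < d'\<^sup>2" using sq_diff by simp
  thus ?thesis using d'_pos by (simp add: power2_less_imp_less)
qed

lemma tau_pos: "\<tau> > 0"
  using d_less e_pos by (simp add: \<tau>_def)

text \<open>The closing condition is quadratic in \<open>t^2\<close>. The facts \<open>p\<close> and
  \<open>q\<close> are Vieta's relations for its roots, the squares of
  \<open>2 * (d' - d) / e\<close> and \<open>2 * (d' + d) / e\<close>.\<close>

lemma closure_defect_factor:
  "(cmod (m\<^sup>2 + complex_of_real (t\<^sup>2 * e)))\<^sup>2 - 2 * (cmod m)\<^sup>2 + 1 - 2 * (t\<^sup>2 * (a\<^sup>2 + b\<^sup>2)) =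
    e\<^sup>2 * (t\<^sup>2 - \<tau>\<^sup>2) * (t\<^sup>2 - (2 * (d' + d) / e)\<^sup>2)"
proof -
  let ?N = "\<xi>\<^sup>2 + \<eta>\<^sup>2"
  define \<tau>' where "\<tau>' = 2 * (d' + d) / e"
  have t: "e * \<tau> = 2 * (d' - d)" "e * \<tau>' = 2 * (d' + d)" using e_pos by (simp_all add: \<tau>_def \<tau>'_def)
  have "e * (e * \<tau> * \<tau>') = e * (1 - ?N)" using t sq_diff by algebra
  hence p: "e * \<tau> * \<tau>' = 1 - ?N" using e_pos by simp
  have q: "e\<^sup>2 * (\<tau>\<^sup>2 + \<tau>'\<^sup>2) = 2 * (a\<^sup>2 + b\<^sup>2 - e * (\<xi>\<^sup>2 - \<eta>\<^sup>2))"
    using t d_sq d'_sq unfolding e_def by algebra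
  have n: "(cmod (m\<^sup>2 + complex_of_real (t\<^sup>2 * e)))\<^sup>2 = ?N\<^sup>2 + 2 * (t\<^sup>2 * e) * (\<xi>\<^sup>2 - \<eta>\<^sup>2) + (t\<^sup>2 * e)\<^sup>2"
    "(cmod m)\<^sup>2 = ?N"
    unfolding cmod_power2 m_def by (simp_all add: power2_eq_square algebra_simps)
  have "e\<^sup>2 * (t\<^sup>2 - \<tau>\<^sup>2) * (t\<^sup>2 - \<tau>'\<^sup>2) = e\<^sup>2 * (t\<^sup>2)\<^sup>2 - t\<^sup>2 * (e\<^sup>2 * (\<tau>\<^sup>2 + \<tau>'\<^sup>2)) + (e * \<tau> * \<tau>')\<^sup>2"
    by algebra
  thus ?thesis unfolding \<tau>'_def[symmetric] n p q by algebra
qed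

lemma closure: "(cmod k)\<^sup>2 - 2 * (cmod m)\<^sup>2 + 1 = 2 * (\<tau>\<^sup>2 * (a\<^sup>2 + b\<^sup>2))"
  using closure_defect_factor[of \<tau>] by (simp add: k_def \<sigma>_def)

lemma closure_real:
  "(\<xi>\<^sup>2 + \<eta>\<^sup>2)\<^sup>2 + 2 * \<sigma> * (\<xi>\<^sup>2 - \<eta>\<^sup>2) + \<sigma>\<^sup>2 - 2 * (\<xi>\<^sup>2 + \<eta>\<^sup>2) + 1 = 2 * (\<tau>\<^sup>2 * (a\<^sup>2 + b\<^sup>2))"
proof -
  have "(cmod k)\<^sup>2 = (\<xi>\<^sup>2 + \<eta>\<^sup>2)\<^sup>2 + 2 * \<sigma> * (\<xi>\<^sup>2 - \<eta>\<^sup>2) + \<sigma>\<^sup>2" "(cmod m)\<^sup>2 = \<xi>\<^sup>2 + \<eta>\<^sup>2"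
    unfolding cmod_power2 m_def k_def by (simp_all add: power2_eq_square algebra_simps)
  thus ?thesis using closure by simp
qed

lemma sigma_less: "\<sigma> < 1 - (\<xi>\<^sup>2 + \<eta>\<^sup>2)"
proof -
  have "e * \<sigma> = (2 * (d' - d))\<^sup>2" using e_pos by (simp add: \<sigma>_def \<tau>_def power2_eq_square field_simps)
  also have "\<dots> = 4 * (d' - d) * (d' - d)" by algebra
  also have "\<dots> < 4 * (d' - d) * (d' + d)" using d_less d_pos by (intro mult_strict_left_mono) auto
  also have "\<dots> = e * (1 - (\<xi>\<^sup>2 + \<eta>\<^sup>2))" using sq_diff by algebra
  finally show ?thesis using e_pos by simp
qed

text \<open>The two numbers 1 minus squared modulus have a positive product by the closing condition
  and a positive sum by \<open>sigma_less\<close>, so both are positive.\<close>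

lemma foci_in_disc:
  assumes s: "s\<^sup>2 = \<sigma>"
  shows "cmod (m + \<i> * s) < 1" "cmod (m - \<i> * s) < 1"
proof -
  let ?N = "\<xi>\<^sup>2 + \<eta>\<^sup>2"
  have f: "(cmod (m + \<i> * s))\<^sup>2 = ?N + s\<^sup>2 + 2 * s * \<eta>" and g: "(cmod (m - \<i> * s))\<^sup>2 = ?N + s\<^sup>2 - 2 * s * \<eta>"
    unfolding cmod_power2 m_def by (simp_all add: power2_eq_square algebra_simps)
  have "(1 - (cmod (m + \<i> * s))\<^sup>2) * (1 - (cmod (m - \<i> * s))\<^sup>2) = 4 * (\<tau> * b)\<^sup>2"
    unfolding f g using closure_real s \<sigma>_def e_def by algebra
  moreover have "0 < 4 * (\<tau> * b)\<^sup>2" using tau_pos b_pos by simp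
  ultimately have "0 < (1 - (cmod (m + \<i> * s))\<^sup>2) * (1 - (cmod (m - \<i> * s))\<^sup>2)" by simp
  moreover have "0 < (1 - (cmod (m + \<i> * s))\<^sup>2) + (1 - (cmod (m - \<i> * s))\<^sup>2)"
    unfolding f g using sigma_less s by simp
  ultimately have "0 < 1 - (cmod (m + \<i> * s))\<^sup>2" "0 < 1 - (cmod (m - \<i> * s))\<^sup>2"
    by (auto simp: zero_less_mult_iff)
  thus "cmod (m + \<i> * s) < 1" "cmod (m - \<i> * s) < 1"
    by (simp_all add: power_less_one_iff)
qed

lemma foci_product:
  assumes s: "s\<^sup>2 = \<sigma>"
  shows "(m + \<i> * s) * (m - \<i> * s) = k"
  by (simp add: k_def s[symmetric] power2_eq_square algebra_simps)

lemma norm_k_less: "cmod k < 1"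
proof -
  have s: "(sqrt \<sigma>)\<^sup>2 = \<sigma>" using e_pos by (simp add: \<sigma>_def)
  show ?thesis
    unfolding foci_product[OF s, symmetric] norm_mult
    using foci_in_disc[OF s] by (metis mult_less_cancel_right2 mult_strict_mono' mult_1 norm_ge_zero)
qed

text \<open>The closing condition says exactly that \<open>cmod (1 - cnj f * g)\<close>, for the
  foci \<open>f\<close>, \<open>g\<close>, is the major axis \<open>2 * a * \<tau>\<close> of the
  scaled circle.\<close>

lemma circle_in_ellipse_interior: "sphere (vertex a b m) (a * b * \<tau>) \<subseteq> ellipse_interior a b"
proof -
  define s where "s = sqrt \<sigma>"
  have s: "s\<^sup>2 = \<sigma>" "s > 0" using e_pos tau_pos by (simp_all add: s_def \<sigma>_def)
  show ?thesis
  proof (rule circle_in_ellipse_interior_of_foci[OF a_gt_b b_pos _ _ s(2) foci_in_disc[OF s(1)]])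
    show "0 < a * b * \<tau>" using a_pos b_pos tau_pos by simp
    show "s\<^sup>2 = (a * b * \<tau>)\<^sup>2 * (1 / b\<^sup>2 - 1 / a\<^sup>2)"
      unfolding s \<sigma>_def e_def using a_pos b_pos by (simp add: field_simps)
    have "(cmod (1 - cnj (m + \<i> * s) * (m - \<i> * s)))\<^sup>2 = (1 - (\<xi>\<^sup>2 + \<eta>\<^sup>2) + s\<^sup>2)\<^sup>2 + 4 * s\<^sup>2 * \<xi>\<^sup>2"
      unfolding cmod_power2 m_def by (simp add: power2_eq_square algebra_simps)
    also have "\<dots> = (2 * a * \<tau>)\<^sup>2"
      using closure_real s(1) \<sigma>_def e_def by algebra
    finally show "cmod (1 - cnj (m + \<i> * s) * (m - \<i> * s)) = 2 * (a * b * \<tau>) / b"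
      using a_pos b_pos tau_pos by (simp add: power2_eq_iff_nonneg)
  qed
qed

text \<open>The closing condition has a second root, but a circle with that radius is too large to fit.\<close>
lemma inradius_unique:
  assumes r: "r > 0" and sub: "sphere (vertex a b m) r \<subseteq> ellipse_interior a b"
    and cl: "(cmod (m\<^sup>2 + complex_of_real (t\<^sup>2 * e)))\<^sup>2 - 2 * (cmod m)\<^sup>2 + 1 - 2 * (t\<^sup>2 * (a\<^sup>2 + b\<^sup>2)) = 0"
    and t: "t = r / (a * b)"
  shows "t = \<tau>"
proof -
  have t0: "t > 0" using t r a_pos b_pos by simp
  \<comment> \<open>Highest and lowest points of the circle: adding the two inequalities cancels the
    terms linear in \<open>\<eta>\<close> and bounds \<open>r / b\<close>, which rules out the
    larger root.\<close>
  have "(a * \<xi>, b * \<eta> + r) \<in> ellipse_interior a b" "(a * \<xi>, b * \<eta> - r) \<in> ellipse_interior a b"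
    using r by (auto intro!: subsetD[OF sub] simp: vertex_def m_def dist_Pair_Pair dist_real_def)
  hence "\<xi>\<^sup>2 + (\<eta> + r / b)\<^sup>2 < 1" "\<xi>\<^sup>2 + (\<eta> - r / b)\<^sup>2 < 1"
    using a_pos b_pos by (simp_all add: ellipse_interior_def power_divide[symmetric] add_divide_distrib diff_divide_distrib)
  hence "\<xi>\<^sup>2 + (r / b)\<^sup>2 < 1" 
    using zero_le_power2[of \<eta>] unfolding power2_sum power2_diff by linarith
  moreover have "r / b = a * t" using t a_pos b_pos by simp
  ultimately have at: "(a * t)\<^sup>2 < 1 - \<xi>\<^sup>2" by simp
  have "t < 2 * (d' + d) / e"
  proof -
    have "(e * t)\<^sup>2 * a\<^sup>2 = e\<^sup>2 * (a * t)\<^sup>2" by algebra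
    also have "\<dots> \<le> e\<^sup>2 * (1 - \<xi>\<^sup>2)" using at by (intro mult_left_mono) auto
    also have "\<dots> \<le> e * a\<^sup>2 * (1 - \<xi>\<^sup>2)"
    proof -
      have "0 \<le> 1 - \<xi>\<^sup>2" using at zero_le_power2[of "a * t"] by linarith
      moreover have "e \<le> a\<^sup>2" by (simp add: e_def)
      ultimately show ?thesis
        unfolding power2_eq_square[of e] using e_pos by (intro mult_right_mono mult_left_mono) auto
    qed
    also have "\<dots> \<le> a\<^sup>2 * (2 * d')\<^sup>2"
    proof -
      have "(2 * d')\<^sup>2 = e * (1 - \<xi>\<^sup>2) + b\<^sup>2" using d'_sq by (simp add: e_def algebra_simps)
      hence "e * (1 - \<xi>\<^sup>2) \<le> (2 * d')\<^sup>2" by simp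
      from mult_left_mono[OF this, of "a\<^sup>2"] show ?thesis by (simp add: mult_ac)
    qed
    finally have "(e * t)\<^sup>2 * a\<^sup>2 \<le> (2 * d')\<^sup>2 * a\<^sup>2" by (subst (2) mult.commute)
    hence "(e * t)\<^sup>2 \<le> (2 * d')\<^sup>2" by (rule mult_right_le_imp_le) (use a_pos in simp)
    hence "e * t \<le> 2 * d'" by (rule power2_le_imp_le) (use d'_pos in simp)
    hence "e * t < 2 * (d' + d)" using d_pos by simp
    thus ?thesis using e_pos by (simp add: field_simps)
  qed
  hence "t\<^sup>2 \<noteq> (2 * (d' + d) / e)\<^sup>2" using t0 by (simp add: power2_eq_iff)
  hence "t\<^sup>2 = \<tau>\<^sup>2" using cl e_pos unfolding closure_defect_factor by simp
  thus ?thesis using t0 tau_pos by (simp add: power2_eq_iff)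
qed

text \<open>From left to right, the closing condition and \<open>inradius_unique\<close> pin the
  radius, which therefore disappears. From right to left, the equations are invariant under cyclic
  shifts, so one tangency argument serves all three sides.\<close>

lemma poncelet_family_eq:
  "poncelet_family a b (a * \<xi>, b * \<eta>) = {(vertex a b u, vertex a b v, vertex a b w) | u v w.
     cmod u = 1 \<and> cmod v = 1 \<and> cmod w = 1 \<and> u \<noteq> v \<and> v \<noteq> w \<and> w \<noteq> u \<and>
     u + v + w = 2 * m + u * v * w * cnj k \<and> u * v + v * w + w * u = k + 2 * (u * v * w) * cnj m}"
  (is "_ = ?R")
proof (intro set_eqI iffI)
  have C: "(a * \<xi>, b * \<eta>) = vertex a b m" by (simp add: vertex_def m_def)
  have ab: "a > 0" "b > 0" "a \<noteq> 0" "b \<noteq> 0" using a_pos b_pos by auto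
  have r_sq: "(t\<^sup>2 * e) = r\<^sup>2 * (1 / b\<^sup>2 - 1 / a\<^sup>2)" "t\<^sup>2 * (a\<^sup>2 + b\<^sup>2) = r\<^sup>2 * (1 / a\<^sup>2 + 1 / b\<^sup>2)"
    if "t = r / (a * b)" for t r
    using ab by (simp_all add: that e_def field_simps)
  have ck: "cnj k = (cnj m)\<^sup>2 + \<sigma>" by (simp add: k_def)
  {
    fix T assume "T \<in> poncelet_family a b (a * \<xi>, b * \<eta>)"
    then obtain P Q R r where T: "T = (P, Q, R)" and on: "{P, Q, R} \<subseteq> ellipse a b"
      and nc: "\<not> collinear {P, Q, R}" and r: "r > 0"
      and sub: "sphere (vertex a b m) r \<subseteq> ellipse_interior a b"
      and tan: "tangent_to_circle (vertex a b m) r P Q" "tangent_to_circle (vertex a b m) r Q R"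
        "tangent_to_circle (vertex a b m) r R P"
      unfolding poncelet_family_def C by blast
    have "P \<in> vertex a b ` {u. cmod u = 1}" "Q \<in> vertex a b ` {u. cmod u = 1}"
      "R \<in> vertex a b ` {u. cmod u = 1}"
      using on unfolding ellipse_eq_image[OF ab(3,4)] by simp_all
    then obtain u v w where n: "cmod u = 1" "cmod v = 1" "cmod w = 1"
      and PQR: "P = vertex a b u" "Q = vertex a b v" "R = vertex a b w"
      by (elim imageE) simp
    have "P \<noteq> Q" "Q \<noteq> R" using nc by auto
    moreover have "R \<noteq> P"
    proof
      assume "R = P"
      hence "{P, Q, R} = {P, Q}" by blast
      thus False using nc by simp
    qed
    ultimately have d: "u \<noteq> v" "v \<noteq> w" "w \<noteq> u" using PQR by auto
    define t where "t = r / (a * b)"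
    note rs = r_sq[OF t_def]
    have t0: "tangency m (t\<^sup>2 * e) (t\<^sup>2 * (a\<^sup>2 + b\<^sup>2)) u v = 0"
      "tangency m (t\<^sup>2 * e) (t\<^sup>2 * (a\<^sup>2 + b\<^sup>2)) v w = 0"
      "tangency m (t\<^sup>2 * e) (t\<^sup>2 * (a\<^sup>2 + b\<^sup>2)) w u = 0"
      using tan tangent_chord_iff[OF ab(1,2) r n(1,2) d(1) rs] tangent_chord_iff[OF ab(1,2) r n(2,3) d(2) rs]
        tangent_chord_iff[OF ab(1,2) r n(3,1) d(3) rs] unfolding PQR by blast+
    note sym = triangle_elementary_symmetric[OF d t0]
    have "u \<noteq> 0" "v \<noteq> 0" using n by auto
    with tangency_eq_closure_defect[OF sym, of "t\<^sup>2 * (a\<^sup>2 + b\<^sup>2)"] t0(1)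
    have "(cmod (m\<^sup>2 + complex_of_real (t\<^sup>2 * e)))\<^sup>2 - 2 * (cmod m)\<^sup>2 + 1 - 2 * (t\<^sup>2 * (a\<^sup>2 + b\<^sup>2)) = 0"
      by (metis mult_eq_0_iff of_real_eq_0_iff)
    hence "t = \<tau>" by (rule inradius_unique[OF r sub _ t_def])
    hence "t\<^sup>2 * e = \<sigma>" by (simp add: \<sigma>_def)
    with sym show "T \<in> ?R" unfolding T PQR ck k_def using n d by auto
  next
    fix T assume "T \<in> ?R"
    then obtain u v w where T: "T = (vertex a b u, vertex a b v, vertex a b w)"
      and n: "cmod u = 1" "cmod v = 1" "cmod w = 1" and d: "u \<noteq> v" "v \<noteq> w" "w \<noteq> u"
      and sym: "u + v + w = 2 * m + u * v * w * cnj k" "u * v + v * w + w * u = k + 2 * (u * v * w) * cnj m"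
      by blast
    define r where "r = a * b * \<tau>"
    have r: "r > 0" using ab tau_pos by (simp add: r_def)
    have tr: "\<tau> = r / (a * b)" using ab by (simp add: r_def)
    note rs = r_sq[OF tr, folded \<sigma>_def]
    have tan: "tangent_to_circle (vertex a b m) r (vertex a b u') (vertex a b v')"
      if n': "cmod u' = 1" "cmod v' = 1" and d': "u' \<noteq> v'"
        and sym': "u' + v' + w' = 2 * m + u' * v' * w' * cnj k"
          "u' * v' + v' * w' + w' * u' = k + 2 * (u' * v' * w') * cnj m" for u' v' w'
    proof -
      have sym\<^sub>0: "u' + v' + w' = 2 * m + u' * v' * w' * ((cnj m)\<^sup>2 + \<sigma>)"
        "u' * v' + v' * w' + w' * u' = m\<^sup>2 + \<sigma> + 2 * (u' * v' * w') * cnj m"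
        using sym' by (simp_all add: k_def)
      have "tangency m \<sigma> (\<tau>\<^sup>2 * (a\<^sup>2 + b\<^sup>2)) u' v' = 0"
        using tangency_eq_closure_defect[OF sym\<^sub>0, of "\<tau>\<^sup>2 * (a\<^sup>2 + b\<^sup>2)"] closure
        unfolding k_def by simp
      thus ?thesis using tangent_chord_iff[OF ab(1,2) r n' d' rs] by blast
    qed
    have "tangent_to_circle (vertex a b m) r (vertex a b u) (vertex a b v)"
      by (rule tan[OF n(1,2) d(1) sym])
    moreover have "tangent_to_circle (vertex a b m) r (vertex a b v) (vertex a b w)"
      by (rule tan[OF n(2,3) d(2), of u]) (use sym in \<open>simp_all add: algebra_simps\<close>)
    moreover have "tangent_to_circle (vertex a b m) r (vertex a b w) (vertex a b u)"
      by (rule tan[OF n(3,1) d(3), of v]) (use sym in \<open>simp_all add: algebra_simps\<close>)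
    ultimately show "T \<in> poncelet_family a b (a * \<xi>, b * \<eta>)"
      unfolding T C poncelet_family_def
      using n r circle_in_ellipse_interior[folded r_def] not_collinear_vertices[OF ab(1,2) n d]
      by (auto simp: ellipse_eq_image[OF ab(3,4)])
  }
qed

lemma blaschke_fibre_distinct:
  assumes n: "cmod u = 1" "cmod v = 1" "cmod w = 1"
    and sym: "u + v + w = 2 * m + u * v * w * cnj k" "u * v + v * w + w * u = k + 2 * (u * v * w) * cnj m"
  shows "u \<noteq> v"
proof
  \<comment> \<open>At a double root the tangent of the ellipse would touch the circle, which lies inside.\<close>
  assume uv: "u = v"
  define p q where "p = Re u" and "q = Im u"
  have pq: "p\<^sup>2 + q\<^sup>2 = 1" using n(1) by (simp add: cmod_def p_def q_def)
  have sym\<^sub>0: "u + v + w = 2 * m + u * v * w * ((cnj m)\<^sup>2 + \<sigma>)"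
    "u * v + v * w + w * u = m\<^sup>2 + \<sigma> + 2 * (u * v * w) * cnj m"
    using sym by (simp_all add: k_def)
  have "tangency m \<sigma> (\<tau>\<^sup>2 * (a\<^sup>2 + b\<^sup>2)) u u = 0"
    using tangency_eq_closure_defect[OF sym\<^sub>0, of "\<tau>\<^sup>2 * (a\<^sup>2 + b\<^sup>2)"] closure
    unfolding k_def uv by simp
  moreover have "u \<noteq> 0" using n by auto
  ultimately have "4 * (1 - Re (m * cnj u))\<^sup>2 + 2 * \<sigma> * Re (u\<^sup>2) - 2 * (\<tau>\<^sup>2 * (a\<^sup>2 + b\<^sup>2)) = 0"
    unfolding tangency_self[OF n(1)] mult_eq_0_iff of_real_eq_0_iff by simp
  hence "4 * (1 - (\<xi> * p + \<eta> * q))\<^sup>2 + 2 * \<sigma> * (p\<^sup>2 - q\<^sup>2) - 2 * (\<tau>\<^sup>2 * (a\<^sup>2 + b\<^sup>2)) = 0"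
    by (simp add: m_def p_def q_def power2_eq_square)
  hence T: "(1 - (\<xi> * p + \<eta> * q))\<^sup>2 = \<tau>\<^sup>2 * ((b * p)\<^sup>2 + (a * q)\<^sup>2)"
    using pq \<sigma>_def e_def by algebra
  define L where "L = sqrt ((b * p)\<^sup>2 + (a * q)\<^sup>2)"
  have "p \<noteq> 0 \<or> q \<noteq> 0" using pq by auto
  hence "0 < (b * p)\<^sup>2 + (a * q)\<^sup>2" using a_pos b_pos by (simp add: sum_power2_gt_zero_iff)
  hence L: "L > 0" "L\<^sup>2 = (b * p)\<^sup>2 + (a * q)\<^sup>2" by (simp_all add: L_def)
  have "(\<xi> * p + \<eta> * q)\<^sup>2 \<le> (\<xi>\<^sup>2 + \<eta>\<^sup>2) * (p\<^sup>2 + q\<^sup>2)"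
  proof -
    have "(\<xi>\<^sup>2 + \<eta>\<^sup>2) * (p\<^sup>2 + q\<^sup>2) - (\<xi> * p + \<eta> * q)\<^sup>2 = (\<xi> * q - \<eta> * p)\<^sup>2" by algebra
    thus ?thesis using zero_le_power2[of "\<xi> * q - \<eta> * p"] by linarith
  qed
  hence "(\<xi> * p + \<eta> * q)\<^sup>2 < 1\<^sup>2" using pq inside by simp
  hence "\<xi> * p + \<eta> * q < 1" by (rule power2_less_imp_less) simp
  moreover have "(1 - (\<xi> * p + \<eta> * q))\<^sup>2 = (\<tau> * L)\<^sup>2"
    unfolding power_mult_distrib[of \<tau>] L(2) by (rule T)
  ultimately have touch: "1 - (\<xi> * p + \<eta> * q) = \<tau> * L"
    using L(1) tau_pos by (metis power2_eq_imp_eq less_imp_le diff_gt_0_iff_gt mult_nonneg_nonneg)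
  \<comment> \<open>The point of the scaled circle farthest in direction \<open>(p, q)\<close>; it
    lies on the tangent of the unit circle at \<open>u\<close>, hence not inside.\<close>
  define x y where "x = \<xi> + \<tau> * (b\<^sup>2 * p) / L" and "y = \<eta> + \<tau> * (a\<^sup>2 * q) / L"
  have "(a * x, b * y) \<in> sphere (vertex a b m) (a * b * \<tau>)"
  proof -
    have "(a * \<xi> - a * x)\<^sup>2 + (b * \<eta> - b * y)\<^sup>2 = (a * b * \<tau>)\<^sup>2 * (((b * p)\<^sup>2 + (a * q)\<^sup>2) / L\<^sup>2)"
      using L(1) by (simp add: x_def y_def field_simps power2_eq_square)
    also have "\<dots> = (a * b * \<tau>)\<^sup>2" unfolding L(2)[symmetric] using L(1) by simp
    finally show ?thesis using a_pos b_pos tau_pos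
      by (simp add: vertex_def m_def dist_Pair_Pair dist_real_def)
  qed
  hence "(a * x, b * y) \<in> ellipse_interior a b" using circle_in_ellipse_interior by blast
  hence xy: "x\<^sup>2 + y\<^sup>2 < 1"
    using a_pos b_pos by (simp add: ellipse_interior_def power_mult_distrib)
  have "x * p + y * q = (\<xi> * p + \<eta> * q) + \<tau> * (L\<^sup>2 / L)"
    unfolding L(2) using L(1) by (simp add: x_def y_def field_simps power2_eq_square)
  hence "x * p + y * q = 1" using touch L(1) by (simp add: power2_eq_square)
  hence "x\<^sup>2 + y\<^sup>2 = 1 + (x * q - y * p)\<^sup>2" using pq by algebra
  thus False using xy zero_le_power2[of "x * q - y * p"] by linarith
qed

section \<open>The locus of the circumcenter\<close>

definition "G\<^sub>0 = of_real (a + b) - of_real (a - b) * cnj k"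
definition "H\<^sub>0 = of_real (a + b) * k - of_real (a - b)"
definition "G = of_real (e / (8 * a * b)) * G\<^sub>0"
definition "H = of_real (e / (8 * a * b)) * H\<^sub>0"
text \<open>Center and half focal vector of the locus: \<open>Z\<^sub>0 + \<phi>\<close> is real and
  \<open>Z\<^sub>0 - \<phi>\<close> is imaginary, so they lie on the two axes.\<close>

definition "Z\<^sub>0 = of_real (e / (2 * a * b)) * Complex (b * \<xi>) (- a * \<eta>)"
definition "\<phi> = of_real (e / (2 * a * b)) * Complex (b * \<xi>) (a * \<eta>)"

text \<open>The circumcenter depends on the triangle only through \<open>l = u * v * w\<close>, and
  every unimodular \<open>l\<close> occurs, by the Blaschke fibre and the distinctness of its
  points.\<close>

lemma circumcenter_locus_eq:
  "circumcenter_locus a b (a * \<xi>, b * \<eta>) =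
    (\<lambda>l. let Z = Z\<^sub>0 + G * l + H * cnj l in (Re Z, Im Z)) ` {l. cmod l = 1}"
proof -
  have ab: "a \<noteq> 0" "b \<noteq> 0" using a_pos b_pos by auto
  define S where "S = {(u, v, w). cmod u = 1 \<and> cmod v = 1 \<and> cmod w = 1 \<and> u \<noteq> v \<and> v \<noteq> w \<and> w \<noteq> u \<and>
     u + v + w = 2 * m + u * v * w * cnj k \<and> u * v + v * w + w * u = k + 2 * (u * v * w) * cnj m}"
  have fam: "poncelet_family a b (a * \<xi>, b * \<eta>) = (\<lambda>(u, v, w). (vertex a b u, vertex a b v, vertex a b w)) ` S"
    unfolding poncelet_family_eq S_def
    by (simp only: image_def Bex_def split_paired_Ex mem_Collect_eq prod.case) blast
  have centre: "circumcenter (vertex a b u, vertex a b v, vertex a b w) =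
      (let Z = Z\<^sub>0 + G * (u * v * w) + H * cnj (u * v * w) in (Re Z, Im Z))"
    if "(u, v, w) \<in> S" for u v w
  proof -
    from that have n: "cmod u = 1" "cmod v = 1" "cmod w = 1" and d: "u \<noteq> v" "v \<noteq> w" "w \<noteq> u"
      and s: "u + v + w = 2 * m + u * v * w * cnj k" by (auto simp: S_def)
    define l where "l = u * v * w"
    have "((of_real a)\<^sup>2 - (of_real b)\<^sup>2) / 4 * (u + v + w + cnj (u * v * w)) = e / 4 * (2 * m + l * cnj k + cnj l)"
      unfolding s l_def e_def by simp
    from circumcenter_vertices[OF ab n d this[symmetric]] show ?thesis
      unfolding Let_def l_def[symmetric] Z\<^sub>0_def G_def H_def G\<^sub>0_def H\<^sub>0_def m_def using ab
      by (simp add: field_simps)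
  qed
  have "circumcenter (case t of (u, v, w) \<Rightarrow> (vertex a b u, vertex a b v, vertex a b w)) =
      (let Z = Z\<^sub>0 + G * (case t of (u, v, w) \<Rightarrow> u * v * w) + H * cnj (case t of (u, v, w) \<Rightarrow> u * v * w)
       in (Re Z, Im Z))" if "t \<in> S" for t
    using centre that by (cases t) (simp only: prod.case)
  hence "circumcenter_locus a b (a * \<xi>, b * \<eta>) =
      (\<lambda>l. let Z = Z\<^sub>0 + G * l + H * cnj l in (Re Z, Im Z)) ` (\<lambda>(u, v, w). u * v * w) ` S"
    unfolding circumcenter_locus_def fam image_image by (rule image_cong[OF refl])
  also have "(\<lambda>(u, v, w). u * v * w) ` S = {l. cmod l = 1}"
  proof (intro equalityI subsetI)
    fix l assume "l \<in> {l. cmod l = 1}"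
    hence l: "cmod l = 1" by simp
    define s where "s = sqrt \<sigma>"
    have s: "s\<^sup>2 = \<sigma>" using e_pos by (simp add: s_def \<sigma>_def)
    obtain u v w where n: "cmod u = 1" "cmod v = 1" "cmod w = 1" and uvw: "u * v * w = l"
      and e: "u + v + w = (m + \<i> * s) + (m - \<i> * s) + l * cnj ((m + \<i> * s) * (m - \<i> * s))"
        "u * v + v * w + w * u = (m + \<i> * s) * (m - \<i> * s) + l * cnj ((m + \<i> * s) + (m - \<i> * s))"
      using blaschke_fibre[OF foci_in_disc[OF s] l] by metis
    have sym: "u + v + w = 2 * m + u * v * w * cnj k" "u * v + v * w + w * u = k + 2 * (u * v * w) * cnj m"
      using e unfolding foci_product[OF s] uvw by (simp_all add: algebra_simps)
    have "u \<noteq> v" by (rule blaschke_fibre_distinct[OF n sym])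
    moreover have "v \<noteq> w"
      by (rule blaschke_fibre_distinct[OF n(2,3,1)]) (use sym in \<open>simp_all add: algebra_simps\<close>)
    moreover have "w \<noteq> u"
      by (rule blaschke_fibre_distinct[OF n(3,1,2)]) (use sym in \<open>simp_all add: algebra_simps\<close>)
    ultimately show "l \<in> (\<lambda>(u, v, w). u * v * w) ` S"
      using n sym uvw unfolding S_def by force
  qed (auto simp: S_def norm_mult)
  finally show ?thesis .
qed

lemma k_simps: "Re k = \<xi>\<^sup>2 - \<eta>\<^sup>2 + \<sigma>" "Im k = 2 * \<xi> * \<eta>"
  by (simp_all add: k_def m_def power2_eq_square)

lemma norm_k_sq: "1 + (cmod k)\<^sup>2 = 2 * (\<xi>\<^sup>2 + \<eta>\<^sup>2) + 2 * (\<tau>\<^sup>2 * (a\<^sup>2 + b\<^sup>2))"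
proof -
  have "(cmod m)\<^sup>2 = \<xi>\<^sup>2 + \<eta>\<^sup>2" by (simp add: m_def cmod_def)
  thus ?thesis using closure by simp
qed

text \<open>By the closing condition the terms with \<open>\<tau>\<close> cancel and the product is
  a perfect square. This is what places the foci on the axes.\<close>

lemma G0_H0_product: "G\<^sub>0 * H\<^sub>0 = 4 * (Complex (b * \<xi>) (a * \<eta>))\<^sup>2"
proof (rule complex_eqI)
  have "Re (G\<^sub>0 * H\<^sub>0) = 2 * (a\<^sup>2 + b\<^sup>2) * Re k - (a\<^sup>2 - b\<^sup>2) * (1 + (cmod k)\<^sup>2)"
    unfolding cmod_power2 G\<^sub>0_def H\<^sub>0_def by (simp add: power2_eq_square algebra_simps)
  also have "\<dots> = 4 * ((b * \<xi>)\<^sup>2 - (a * \<eta>)\<^sup>2)"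
    unfolding norm_k_sq k_simps \<sigma>_def e_def by algebra
  finally show "Re (G\<^sub>0 * H\<^sub>0) = Re (4 * (Complex (b * \<xi>) (a * \<eta>))\<^sup>2)"
    by (simp add: power2_eq_square)
  have "Im (G\<^sub>0 * H\<^sub>0) = 4 * a * b * Im k"
    unfolding G\<^sub>0_def H\<^sub>0_def by (simp add: power2_eq_square algebra_simps)
  thus "Im (G\<^sub>0 * H\<^sub>0) = Im (4 * (Complex (b * \<xi>) (a * \<eta>))\<^sup>2)"
    by (simp add: k_simps power2_eq_square)
qed

lemma norm_G0_H0_sq:
  "(cmod G\<^sub>0)\<^sup>2 = (a + b)\<^sup>2 + (a - b)\<^sup>2 * (cmod k)\<^sup>2 - 2 * e * Re k"
  "(cmod H\<^sub>0)\<^sup>2 = (a + b)\<^sup>2 * (cmod k)\<^sup>2 + (a - b)\<^sup>2 - 2 * e * Re k"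
  unfolding cmod_power2 G\<^sub>0_def H\<^sub>0_def e_def by (simp_all add: power2_eq_square algebra_simps)

lemma G_H_product: "4 * (G * H) = \<phi>\<^sup>2"
proof -
  have "4 * (G * H) = (of_real (e / (8 * a * b)))\<^sup>2 * 4 * (G\<^sub>0 * H\<^sub>0)"
    by (simp add: G_def H_def power2_eq_square)
  also have "\<dots> = (of_real (2 * (2 * (e / (8 * a * b)))))\<^sup>2 * (Complex (b * \<xi>) (a * \<eta>))\<^sup>2"
    unfolding G0_H0_product of_real_mult[of 2] of_real_numeral by algebra
  also have "\<dots> = \<phi>\<^sup>2" by (simp add: \<phi>_def power_mult_distrib power_divide)
  finally show ?thesis .
qed

lemma norm_G_H: "cmod G = e / (8 * a * b) * cmod G\<^sub>0" "cmod H = e / (8 * a * b) * cmod H\<^sub>0"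
  unfolding G_def H_def norm_mult norm_of_real using e_pos a_pos b_pos by simp_all

text \<open>Nondegeneracy of the locus: the squared moduli of \<open>G\<^sub>0\<close> and
  \<open>H\<^sub>0\<close> differ by a positive multiple of \<open>1 - (cmod k)^2\<close>.\<close>

lemma norm_G_noteq_norm_H: "cmod G \<noteq> cmod H"
proof -
  have "(cmod G\<^sub>0)\<^sup>2 - (cmod H\<^sub>0)\<^sup>2 = 4 * a * b * (1 - (cmod k)\<^sup>2)"
    unfolding norm_G0_H0_sq by algebra
  moreover have "0 < 4 * a * b * (1 - (cmod k)\<^sup>2)"
    using a_pos b_pos norm_k_less by (simp add: power_less_one_iff)
  ultimately have "cmod G\<^sub>0 \<noteq> cmod H\<^sub>0" by auto
  thus ?thesis using e_pos a_pos b_pos by (simp add: norm_G_H)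
qed

text \<open>Since \<open>2 * d' \<le> a\<close> and \<open>b \<le> 2 * d\<close>, the bound reduces
  to \<open>a * b^2 < a^2 * b\<close>. It fixes the sign when the square root for the major
  semi-axis is taken.\<close>

lemma major_axis_pos: "d' * b\<^sup>2 < d * a\<^sup>2"
proof (rule power2_less_imp_less)
  have b: "b\<^sup>2 < a\<^sup>2" using e_pos by (simp add: e_def)
  have "4 * (d' * b\<^sup>2)\<^sup>2 = (4 * d'\<^sup>2) * b\<^sup>2 * b\<^sup>2" by algebra
  also have "\<dots> \<le> a\<^sup>2 * b\<^sup>2 * b\<^sup>2"
    using e_pos unfolding d'_sq e_def[symmetric] by (intro mult_right_mono) auto
  also have "\<dots> < a\<^sup>2 * b\<^sup>2 * a\<^sup>2"
    using a_pos b_pos b by (intro mult_strict_left_mono) auto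
  also have "\<dots> \<le> a\<^sup>2 * (4 * d\<^sup>2) * a\<^sup>2"
    using e_pos unfolding d_sq e_def[symmetric] by (intro mult_right_mono mult_left_mono) auto
  also have "\<dots> = 4 * (d * a\<^sup>2)\<^sup>2" by algebra
  finally show "(d' * b\<^sup>2)\<^sup>2 < (d * a\<^sup>2)\<^sup>2" by simp
qed (use d_pos in simp)

text \<open>Squaring the sum leaves only the product of the moduli as cross term, known from
  \<open>G0_H0_product\<close>. With the equations for \<open>d\<close> and \<open>d'\<close> the
  result is the square of a linear form in them.\<close>

lemma norm_G_plus_norm_H: "cmod G + cmod H = d * (a / b) - d' * (b / a)"
proof -
  define w where "w = (b * \<xi>)\<^sup>2 + (a * \<eta>)\<^sup>2"
  have et: "e * \<tau> = 2 * (d' - d)" using e_pos by (simp add: \<tau>_def)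
  have prod: "cmod G\<^sub>0 * cmod H\<^sub>0 = 4 * w"
    unfolding norm_mult[symmetric] G0_H0_product by (simp add: norm_mult norm_power w_def cmod_power2)
  have "(cmod G\<^sub>0 + cmod H\<^sub>0)\<^sup>2 = (cmod G\<^sub>0)\<^sup>2 + (cmod H\<^sub>0)\<^sup>2 + 2 * (cmod G\<^sub>0 * cmod H\<^sub>0)"
    by algebra
  also have "\<dots> = 2 * (a\<^sup>2 + b\<^sup>2) * (1 + (cmod k)\<^sup>2) - 4 * e * Re k + 8 * w"
    unfolding prod norm_G0_H0_sq by algebra
  also have "\<dots> = 16 * (w + (a * b * \<tau>)\<^sup>2)"
    unfolding norm_k_sq k_simps w_def \<sigma>_def e_def by algebra
  finally have sum: "(cmod G\<^sub>0 + cmod H\<^sub>0)\<^sup>2 = \<dots>" .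
  have "e * (cmod G\<^sub>0 + cmod H\<^sub>0) = 8 * (d * a\<^sup>2 - d' * b\<^sup>2)"
  proof (rule power2_eq_imp_eq)
    have "(e * (cmod G\<^sub>0 + cmod H\<^sub>0))\<^sup>2 = 16 * (e\<^sup>2 * w + (a * b)\<^sup>2 * (e * \<tau>)\<^sup>2)"
      unfolding power_mult_distrib[of e] sum by algebra
    also have "\<dots> = (8 * (d * a\<^sup>2 - d' * b\<^sup>2))\<^sup>2"
      unfolding et w_def using d_sq d'_sq e_def by algebra
    finally show "(e * (cmod G\<^sub>0 + cmod H\<^sub>0))\<^sup>2 = (8 * (d * a\<^sup>2 - d' * b\<^sup>2))\<^sup>2" .
  qed (use e_pos major_axis_pos in auto)
  moreover have "cmod G + cmod H = e * (cmod G\<^sub>0 + cmod H\<^sub>0) / (8 * a * b)"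
    by (simp add: norm_G_H add_divide_distrib distrib_left)
  ultimately show ?thesis using a_pos b_pos by (simp add: field_simps power2_eq_square)
qed

lemma circumcenter_locus_foci:
  "circumcenter_locus a b (a * \<xi>, b * \<eta>) =
    {X. dist X (e * \<xi> / a, 0) + dist X (0, - e * \<eta> / b) = 2 * (d * (a / b) - d' * (b / a))}"
proof -
  define g h where "g = csqrt G" and "h = csqrt H"
  have gh: "g\<^sup>2 = G" "h\<^sup>2 = H" by (simp_all add: g_def h_def)
  have ngh: "(cmod g)\<^sup>2 = cmod G" "(cmod h)\<^sup>2 = cmod H"
    unfolding norm_power[symmetric] gh by simp_all
  have "(2 * g * h)\<^sup>2 = \<phi>\<^sup>2" using G_H_product gh by algebra
  \<comment> \<open>The branches of the square roots leave the sign open; the other sign only swaps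
    the foci.\<close>
  hence foci: "2 * g * h = \<phi> \<or> 2 * g * h = - \<phi>" by (simp add: power2_eq_iff)
  have ne: "cmod g \<noteq> cmod h" using norm_G_noteq_norm_H ngh by auto
  have param: "Z \<in> (\<lambda>l. G * l + H * cnj l) ` {l. cmod l = 1} \<longleftrightarrow>
      cmod (Z - \<phi>) + cmod (Z + \<phi>) = 2 * (d * (a / b) - d' * (b / a))" for Z
    unfolding ellipse_param[OF ne, unfolded gh ngh norm_G_plus_norm_H, symmetric] mem_Collect_eq
    using foci by (auto simp: add.commute)
  have F: "dist X (e * \<xi> / a, 0) = cmod (Complex (fst X) (snd X) - Z\<^sub>0 - \<phi>)"
    "dist X (0, - e * \<eta> / b) = cmod (Complex (fst X) (snd X) - Z\<^sub>0 + \<phi>)" for X :: point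
  proof -
    have "Complex (fst X) (snd X) - Z\<^sub>0 - \<phi> = Complex (fst X - e * \<xi> / a) (snd X)"
      "Complex (fst X) (snd X) - Z\<^sub>0 + \<phi> = Complex (fst X) (snd X + e * \<eta> / b)"
      using a_pos b_pos by (simp_all add: Z\<^sub>0_def \<phi>_def complex_eq_iff)
    thus "dist X (e * \<xi> / a, 0) = cmod (Complex (fst X) (snd X) - Z\<^sub>0 - \<phi>)"
      "dist X (0, - e * \<eta> / b) = cmod (Complex (fst X) (snd X) - Z\<^sub>0 + \<phi>)"
      by (simp_all add: dist_prod_def dist_real_def cmod_def)
  qed
  have "X \<in> circumcenter_locus a b (a * \<xi>, b * \<eta>) \<longleftrightarrow>
      Complex (fst X) (snd X) - Z\<^sub>0 \<in> (\<lambda>l. G * l + H * cnj l) ` {l. cmod l = 1}" for X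
  proof -
    have "X = (let Z = Z\<^sub>0 + G * l + H * cnj l in (Re Z, Im Z)) \<longleftrightarrow>
        Complex (fst X) (snd X) - Z\<^sub>0 = G * l + H * cnj l" for l
      by (cases X) (auto simp: Let_def complex_eq_iff algebra_simps)
    thus ?thesis unfolding circumcenter_locus_eq image_iff by simp
  qed
  thus ?thesis unfolding param F by blast
qed

end

theorem proposition6:
  fixes a b c x\<^sub>c y\<^sub>c \<delta>\<^sub>3 \<delta>\<^sub>3' :: real and C F\<^sub>3 F\<^sub>3' :: "real \<times> real"
  assumes "a > b" and "b > 0" and "c\<^sup>2 = a\<^sup>2 - b\<^sup>2"
    and "C = (x\<^sub>c, y\<^sub>c)" and "C \<in> ellipse_interior a b"
    and "\<delta>\<^sub>3 = sqrt (b ^ 4 + c\<^sup>2 * y\<^sub>c\<^sup>2) / (2 * b)"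
    and "\<delta>\<^sub>3' = sqrt (a ^ 4 - c\<^sup>2 * x\<^sub>c\<^sup>2) / (2 * a)"
    and "F\<^sub>3 = (x\<^sub>c * (1 - (b / a)\<^sup>2), 0)"
    and "F\<^sub>3' = (0, y\<^sub>c * (1 - (a / b)\<^sup>2))"
  shows "is_ellipse (circumcenter_locus a b C) F\<^sub>3 F\<^sub>3'
           (\<delta>\<^sub>3 * (a / b) - \<delta>\<^sub>3' * (b / a)) (\<delta>\<^sub>3' - \<delta>\<^sub>3)
         \<and> collinear {F\<^sub>3, F\<^sub>3', C} \<and> snd F\<^sub>3 = 0 \<and> fst F\<^sub>3' = 0"
proof -
  have ab: "a > 0" "b > 0" using assms(1,2) by auto
  define \<xi> \<eta> where "\<xi> = x\<^sub>c / a" and "\<eta> = y\<^sub>c / b"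
  have xy: "x\<^sub>c = a * \<xi>" "y\<^sub>c = b * \<eta>" using ab by (simp_all add: \<xi>_def \<eta>_def)
  have inside: "\<xi>\<^sup>2 + \<eta>\<^sup>2 < 1"
    using assms(4,5) by (simp add: ellipse_interior_def \<xi>_def \<eta>_def power_divide)
  have cc: "0 < c\<^sup>2" "c\<^sup>2 < a\<^sup>2" using assms(1-3) by (auto simp: power_strict_mono)
  have rad': "0 < a ^ 4 - c\<^sup>2 * x\<^sub>c\<^sup>2"
  proof -
    have "\<xi>\<^sup>2 < 1" using inside zero_le_power2[of \<eta>] by linarith
    hence "c\<^sup>2 * \<xi>\<^sup>2 \<le> c\<^sup>2 * 1" by (intro mult_left_mono) auto
    hence "c\<^sup>2 * \<xi>\<^sup>2 < a\<^sup>2 * 1" using cc(2) by linarith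
    hence "a\<^sup>2 * (c\<^sup>2 * \<xi>\<^sup>2) < a\<^sup>2 * (a\<^sup>2 * 1)" using ab by (intro mult_strict_left_mono) auto
    thus ?thesis by (simp add: xy power_mult_distrib power2_eq_square power4_eq_xxxx mult_ac)
  qed
  have rad: "0 < b ^ 4 + c\<^sup>2 * y\<^sub>c\<^sup>2" using ab by (simp add: add_pos_nonneg)
  have d_sq: "4 * \<delta>\<^sub>3\<^sup>2 = b\<^sup>2 + (a\<^sup>2 - b\<^sup>2) * \<eta>\<^sup>2"
  proof -
    have "\<delta>\<^sub>3\<^sup>2 = (b ^ 4 + c\<^sup>2 * y\<^sub>c\<^sup>2) / (4 * b\<^sup>2)"
      using rad ab by (simp add: assms(6) power_divide power_mult_distrib)
    also have "b ^ 4 + c\<^sup>2 * y\<^sub>c\<^sup>2 = b\<^sup>2 * (b\<^sup>2 + (a\<^sup>2 - b\<^sup>2) * \<eta>\<^sup>2)"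
      unfolding assms(3) xy by algebra
    finally show ?thesis using ab by simp
  qed
  have d'_sq: "4 * \<delta>\<^sub>3'\<^sup>2 = a\<^sup>2 - (a\<^sup>2 - b\<^sup>2) * \<xi>\<^sup>2"
  proof -
    have "\<delta>\<^sub>3'\<^sup>2 = (a ^ 4 - c\<^sup>2 * x\<^sub>c\<^sup>2) / (4 * a\<^sup>2)"
      using rad' ab by (simp add: assms(7) power_divide power_mult_distrib)
    also have "a ^ 4 - c\<^sup>2 * x\<^sub>c\<^sup>2 = a\<^sup>2 * (a\<^sup>2 - (a\<^sup>2 - b\<^sup>2) * \<xi>\<^sup>2)"
      unfolding assms(3) xy by algebra
    finally show ?thesis using ab by simp
  qed
  interpret incircle_family a b \<xi> \<eta> \<delta>\<^sub>3 \<delta>\<^sub>3'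
    by unfold_locales (use assms(1,2) inside d_sq d'_sq rad rad' ab in \<open>auto simp: assms(6,7)\<close>)
  have F: "F\<^sub>3 = (e * \<xi> / a, 0)" "F\<^sub>3' = (0, - e * \<eta> / b)"
    unfolding assms(8,9) e_def xy using ab by (auto simp: field_simps power2_eq_square)
  let ?\<alpha> = "\<delta>\<^sub>3 * (a / b) - \<delta>\<^sub>3' * (b / a)" and ?\<beta> = "\<delta>\<^sub>3' - \<delta>\<^sub>3"
  have \<alpha>: "a * b * ?\<alpha> = \<delta>\<^sub>3 * a\<^sup>2 - \<delta>\<^sub>3' * b\<^sup>2"
    using ab by (simp add: field_simps power2_eq_square)
  hence \<alpha>_pos: "0 < ?\<alpha>" using major_axis_pos ab by (metis diff_gt_0_iff_gt mult_pos_pos zero_less_mult_pos)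
  \<comment> \<open>Only the sum of the moduli of \<open>G\<close> and \<open>H\<close> was
    computed; the minor semi-axis is identified through the focal distance.\<close>
  have axes: "(dist F\<^sub>3 F\<^sub>3' / 2)\<^sup>2 = ?\<alpha>\<^sup>2 - ?\<beta>\<^sup>2"
  proof -
    have "(a * b)\<^sup>2 * (4 * (dist F\<^sub>3 F\<^sub>3' / 2)\<^sup>2) = e\<^sup>2 * ((b * \<xi>)\<^sup>2 + (a * \<eta>)\<^sup>2)"
      using ab by (simp add: F dist_Pair_Pair dist_real_def power_divide field_simps)
    also have "\<dots> = 4 * ((a * b * ?\<alpha>)\<^sup>2 - (a * b * ?\<beta>)\<^sup>2)"
      unfolding \<alpha> using d_sq d'_sq e_def by algebra
    also have "\<dots> = (a * b)\<^sup>2 * (4 * (?\<alpha>\<^sup>2 - ?\<beta>\<^sup>2))" by algebra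
    finally show ?thesis using ab by simp
  qed
  have "?\<beta> \<le> ?\<alpha>"
    by (rule power2_le_imp_le) (use axes \<alpha>_pos zero_le_power2[of "dist F\<^sub>3 F\<^sub>3' / 2"] in linarith)+
  moreover have "collinear {F\<^sub>3, F\<^sub>3', C}"
  proof -
    \<comment> \<open>Seen from \<open>C\<close>, the foci are
      \<open>- (x\<^sub>c * (b / a)^2, y\<^sub>c)\<close> and
      \<open>- (x\<^sub>c, y\<^sub>c * (a / b)^2)\<close>, with ratio
      \<open>(a / b)^2\<close>.\<close>
    have "F\<^sub>3' = C + (a\<^sup>2 / b\<^sup>2) *\<^sub>R (F\<^sub>3 - C)"
      unfolding assms(4,8,9) using ab by (auto simp: field_simps)
    hence "F\<^sub>3' \<in> affine hull {C, F\<^sub>3}" unfolding affine_hull_2_alt by blast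
    hence "collinear {C, F\<^sub>3, F\<^sub>3'}" by (rule affine_hull_3_imp_collinear)
    thus ?thesis by (simp add: insert_commute)
  qed
  ultimately show ?thesis
    unfolding is_ellipse_def using d_less axes circumcenter_locus_foci
    by (simp add: F assms(4) xy)
qed

end
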